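(* Let $\alpha>0$, $\gamma\ge0$, let $\kappa$ be a fragmentation kernel and let $\mu_0$ be an admissible initial datum. Then the power series solution of the fragmentation equation with initial datum $\mu_0$, $$\mu_t=e^{-\alpha x^\gamma t}\mu_0+\sum_{n=0}^\infty(\alpha t)^n\, a_n\ast b_n,\qquad db_n(\ell)=\ell^{n\gamma}\,d\mu_0(\ell),$$ where $$a_0=0,\qquad a_{n+1}=\frac1{n+1}\Big(-x^\gamma a_n+\kappa\ast(y^\gamma a_n)+\frac{(-1)^n}{n!}\kappa\Big),$$ is non-negative.
   Context: $\mathbb R^+=[0,\infty)$. $\mathcal M(\mathbb R^+)$ is the space of signed Radon measures supported in $\mathbb R^+$, endowed with the total variation norm $\|\cdot\|_{TV}$, for which it is a Banach space (so its elements are finite measures); $\mathcal M^+(\mathbb R^+)$ is the subset of non-negative measures. The series converges in this Banach space. Fragmentation kernel: $\kappa\in\mathcal M^+(\mathbb R^+)$ with no atom at $0$ nor at $1$, $\operatorname{supp}(\kappa)\subset[0,1]$, $\int_0^1 d\kappa(z)=N<+\infty$, $\int_0^1 z\,d\kappa(z)=1$. Admissible initial datum: $\mu_0\in\mathcal M^+(\mathbb R^+)$ compactly supported, $\operatorname{supp}(\mu_0)\subset[0,L]$. Fragmentation equation (formally): $\partial_t\mu_t(x)=-\alpha x^\gamma\mu_t(x)+\alpha\int_x^\infty\kappa(x/y)\,y^{\gamma-1}d\mu_t(y)$, $\mu_{t=0}=\mu_0$. Mellin (multiplicative) convolution of two compactly supported finite measures on $\mathbb R^+$: $\int\varphi\,d(\mu\ast\nu)=\iint\varphi(xy)\,d\mu(x)\,d\nu(y)$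 for all $\varphi\in\mathcal C(\mathbb R^+)$. Here $x^\gamma a_n$ (or $y^\gamma a_n$) denotes $a_n$ multiplied by the function $x\mapsto x^\gamma$. *)

theory Defs
  imports "HOL-Analysis.Analysis"
begin

text \<open>Finite signed Borel measures supported in \<open>[0,\<infinity>)\<close>, as set functions on the Borel sets of the
  real line (finite Borel measures on the line are automatically Radon). The value on non-Borel
  sets is fixed to 0 so that equality of measures is equality of functions.\<close>

typedef smeasure = "{\<nu> :: real set \<Rightarrow> real.
    (\<forall>A. range A \<subseteq> sets borel \<longrightarrow> disjoint_family A \<longrightarrow> (\<lambda>n::nat. \<nu> (A n)) sums \<nu> (\<Union>n. A n)) \<and>
    (\<forall>A\<in>sets borel. A \<inter> {0..} = {} \<longrightarrow> \<nu> A = 0) \<and>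
    (\<forall>A. A \<notin> sets borel \<longrightarrow> \<nu> A = 0)}"
  morphisms smeas Abs_smeasure
  by (rule exI[of _ "\<lambda>_. 0"]) simp

setup_lifting type_definition_smeasure

lemma smeas_sums:
  "range A \<subseteq> sets borel \<Longrightarrow> disjoint_family A \<Longrightarrow> (\<lambda>n::nat. smeas \<nu> (A n)) sums smeas \<nu> (\<Union>n. A n)"
  using smeas[of \<nu>] by simp

lemma smeas_not_borel: "A \<notin> sets borel \<Longrightarrow> smeas \<nu> A = 0"
  using smeas[of \<nu>] by simp

lemma smeas_outside: "A \<inter> {0..} = {} \<Longrightarrow> smeas \<nu> A = 0"
  using smeas[of \<nu>] by (cases "A \<in> sets borel") simp_all

lemma smeasure_eqI: "(\<And>A. A \<in> sets borel \<Longrightarrow> smeas \<mu> A = smeas \<nu> A) \<Longrightarrow> \<mu> = \<nu>"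
  unfolding smeas_inject[symmetric] by (rule ext) (metis smeas_not_borel)

lemma smeas_empty [simp]: "smeas \<nu> {} = 0"
  by (rule smeas_outside) simp

lemma smeas_Un:
  assumes "A \<in> sets borel" "B \<in> sets borel" "A \<inter> B = {}"
  shows "smeas \<nu> (A \<union> B) = smeas \<nu> A + smeas \<nu> B"
proof -
  have "(\<lambda>n. smeas \<nu> (binaryset A B n)) sums smeas \<nu> (\<Union>n. binaryset A B n)"
    using assms by (intro smeas_sums) (auto simp: binaryset_def disjoint_family_on_def)
  moreover have "(\<lambda>n. smeas \<nu> (binaryset A B n)) sums (smeas \<nu> A + smeas \<nu> B)"
    by (rule binaryset_sums) simp
  ultimately show ?thesis
    by (simp add: UN_binaryset_eq sums_unique2)
qed

lemma smeas_Diff: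
  assumes "A \<in> sets borel" "B \<in> sets borel" "B \<subseteq> A"
  shows "smeas \<nu> (A - B) = smeas \<nu> A - smeas \<nu> B"
proof -
  have "smeas \<nu> ((A - B) \<union> B) = smeas \<nu> (A - B) + smeas \<nu> B"
    using assms by (intro smeas_Un) auto
  moreover have "(A - B) \<union> B = A" using assms by auto
  ultimately show ?thesis by simp
qed

lemma smeas_finite_UN:
  assumes "finite I" "\<And>i. i \<in> I \<Longrightarrow> A i \<in> sets borel" "disjoint_family_on A I"
  shows "smeas \<nu> (\<Union>i\<in>I. A i) = (\<Sum>i\<in>I. smeas \<nu> (A i))"
  using assms
proof (induction I rule: finite_induct)
  case (insert i I)
  have "smeas \<nu> (A i \<union> (\<Union>i\<in>I. A i)) = smeas \<nu> (A i) + smeas \<nu> (\<Union>i\<in>I. A i)"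
    using insert by (intro smeas_Un) (auto simp: disjoint_family_on_def)
  with insert show ?case
    by (simp add: disjoint_family_on_def)
qed simp

lemma smeas_decseq:
  assumes B: "range B \<subseteq> sets borel" and dec: "decseq B"
  shows "(\<lambda>n. smeas \<nu> (B n)) \<longlonglongrightarrow> smeas \<nu> (\<Inter>n. B n)"
proof -
  define D where "D n = B n - B (Suc n)" for n
  have Bs: "B n \<in> sets borel" for n using B by auto
  have BI: "(\<Inter>n. B n) \<in> sets borel" using Bs by auto
  have mono: "m \<le> n \<Longrightarrow> B n \<subseteq> B m" for m n using dec by (auto simp: decseq_def)
  have Ds: "range D \<subseteq> sets borel" unfolding D_def using Bs by auto
  have disj: "disjoint_family D"
    unfolding disjoint_family_on_def
  proof (intro ballI impI)
    fix m n :: nat assume "m \<noteq> n"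
    then consider "Suc m \<le> n" | "Suc n \<le> m" by linarith
    then show "D m \<inter> D n = {}"
      by cases (use mono in \<open>auto simp: D_def\<close>)
  qed
  have U: "(\<Union>n. D n) = B 0 - (\<Inter>n. B n)"
  proof
    show "(\<Union>n. D n) \<subseteq> B 0 - (\<Inter>n. B n)" using mono[of 0] by (auto simp: D_def)
    show "B 0 - (\<Inter>n. B n) \<subseteq> (\<Union>n. D n)"
    proof
      fix x assume x: "x \<in> B 0 - (\<Inter>n. B n)"
      then have ex: "\<exists>n. x \<notin> B n" by auto
      define k where "k = (LEAST n. x \<notin> B n)"
      have k: "x \<notin> B k" unfolding k_def using ex by (metis LeastI_ex)
      with x obtain j where j: "k = Suc j" by (cases k) auto
      have "x \<in> B j" using not_less_Least[of j "\<lambda>n. x \<notin> B n"] j k_def by auto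
      with k j show "x \<in> (\<Union>n. D n)" by (auto simp: D_def)
    qed
  qed
  have "(\<Inter>n. B n) \<subseteq> B 0" by blast
  then have U2: "smeas \<nu> (B 0 - (\<Inter>n. B n)) = smeas \<nu> (B 0) - smeas \<nu> (\<Inter>n. B n)"
    by (rule smeas_Diff[OF Bs BI])
  have "(\<lambda>n. smeas \<nu> (D n)) sums smeas \<nu> (\<Union>n. D n)"
    by (rule smeas_sums[OF Ds disj])
  then have "(\<lambda>n. \<Sum>i<n. smeas \<nu> (D i)) \<longlonglongrightarrow> smeas \<nu> (B 0) - smeas \<nu> (\<Inter>n. B n)"
    unfolding sums_def U U2 .
  moreover have "(\<Sum>i<n. smeas \<nu> (D i)) = smeas \<nu> (B 0) - smeas \<nu> (B n)" for n
  proof (induction n)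
    case (Suc n)
    have "smeas \<nu> (D n) = smeas \<nu> (B n) - smeas \<nu> (B (Suc n))"
      unfolding D_def using Bs mono[of n "Suc n"] by (intro smeas_Diff) auto
    with Suc show ?case by simp
  qed simp
  ultimately have "(\<lambda>n. smeas \<nu> (B 0) - smeas \<nu> (B n)) \<longlonglongrightarrow> smeas \<nu> (B 0) - smeas \<nu> (\<Inter>n. B n)"
    by simp
  from tendsto_diff[OF tendsto_const[of "smeas \<nu> (B 0)"] this] show ?thesis by simp
qed

definition positive_set :: "smeasure \<Rightarrow> real set \<Rightarrow> bool" where
  "positive_set \<nu> P \<longleftrightarrow> P \<in> sets borel \<and> (\<forall>B\<in>sets borel. B \<subseteq> P \<longrightarrow> 0 \<le> smeas \<nu> B)"

lemma almost_positive_subset: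
  assumes A: "A \<in> sets borel" and e: "0 < (e::real)"
  shows "\<exists>B\<in>sets borel. B \<subseteq> A \<and> smeas \<nu> A \<le> smeas \<nu> B \<and> (\<forall>C\<in>sets borel. C \<subseteq> B \<longrightarrow> - e < smeas \<nu> C)"
proof (rule ccontr)
  assume neg: "\<not> ?thesis"
  define T where "T = {B \<in> sets borel. B \<subseteq> A \<and> smeas \<nu> A \<le> smeas \<nu> B}"
  have "\<forall>B\<in>T. \<exists>C\<in>sets borel. C \<subseteq> B \<and> smeas \<nu> C \<le> - e"
    using neg unfolding T_def by (auto simp: not_less)
  then obtain c where c: "\<And>B. B \<in> T \<Longrightarrow> c B \<in> sets borel \<and> c B \<subseteq> B \<and> smeas \<nu> (c B) \<le> - e"
    by metis
  define B where "B n = ((\<lambda>X. X - c X) ^^ n) A" for n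
  have BS: "B (Suc n) = B n - c (B n)" for n by (simp add: B_def)
  have BT: "B n \<in> T" for n
  proof (induction n)
    case 0 then show ?case using A by (auto simp: B_def T_def)
  next
    case (Suc n)
    from c[OF Suc] Suc have "smeas \<nu> (B n - c (B n)) = smeas \<nu> (B n) - smeas \<nu> (c (B n))"
      by (intro smeas_Diff) (auto simp: T_def)
    with c[OF Suc] Suc e show ?case unfolding BS by (auto simp: T_def)
  qed
  have dec: "decseq B" by (rule decseq_SucI) (auto simp: BS)
  have "range B \<subseteq> sets borel" using BT by (auto simp: T_def)
  from smeas_decseq[OF this dec, of \<nu>] have lim: "(\<lambda>n. smeas \<nu> (B n)) \<longlonglongrightarrow> smeas \<nu> (\<Inter>n. B n)" .
  have "(\<lambda>n. smeas \<nu> (B (Suc n)) - smeas \<nu> (B n)) \<longlonglongrightarrow> smeas \<nu> (\<Inter>n. B n) - smeas \<nu> (\<Inter>n. B n)"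
    by (intro tendsto_diff LIMSEQ_Suc lim)
  moreover have "e \<le> smeas \<nu> (B (Suc n)) - smeas \<nu> (B n)" for n
  proof -
    have "smeas \<nu> (B n - c (B n)) = smeas \<nu> (B n) - smeas \<nu> (c (B n))"
      using c[OF BT] BT[of n] by (intro smeas_Diff) (auto simp: T_def)
    with c[OF BT[of n]] show ?thesis unfolding BS by auto
  qed
  ultimately have "e \<le> 0" using LIMSEQ_le_const[of _ "0" e] by auto
  with e show False by simp
qed

lemma positive_subset:
  assumes A: "A \<in> sets borel"
  shows "\<exists>P. positive_set \<nu> P \<and> P \<subseteq> A \<and> smeas \<nu> A \<le> smeas \<nu> P"
proof -
  have "\<forall>n X. \<exists>Y. X \<in> sets borel \<longrightarrow> Y \<in> sets borel \<and> Y \<subseteq> X \<and> smeas \<nu> X \<le> smeas \<nu> Y \<and>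
      (\<forall>C\<in>sets borel. C \<subseteq> Y \<longrightarrow> - (1 / real (Suc n)) < smeas \<nu> C)"
    by (metis almost_positive_subset of_nat_0_less_iff zero_less_Suc zero_less_divide_1_iff)
  then obtain f where f: "\<And>n X. X \<in> sets borel \<Longrightarrow> f n X \<in> sets borel \<and> f n X \<subseteq> X \<and>
      smeas \<nu> X \<le> smeas \<nu> (f n X) \<and> (\<forall>C\<in>sets borel. C \<subseteq> f n X \<longrightarrow> - (1 / real (Suc n)) < smeas \<nu> C)"
    by metis
  define B where "B = rec_nat A (\<lambda>n X. f n X)"
  have B0: "B 0 = A" and BS: "B (Suc n) = f n (B n)" for n by (simp_all add: B_def)
  have Bs: "B n \<in> sets borel" for n by (induction n) (use A f in \<open>auto simp: B0 BS\<close>)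
  have dec: "decseq B" by (rule decseq_SucI) (use f Bs in \<open>auto simp: BS\<close>)
  have ge: "smeas \<nu> A \<le> smeas \<nu> (B n)" for n
    by (induction n) (use f Bs in \<open>auto simp: B0 BS intro: order_trans\<close>)
  define P where "P = (\<Inter>n. B n)"
  have Ps: "P \<in> sets borel" unfolding P_def using Bs by auto
  have "(\<lambda>n. smeas \<nu> (B n)) \<longlonglongrightarrow> smeas \<nu> P"
    unfolding P_def by (rule smeas_decseq) (use Bs dec in auto)
  then have "smeas \<nu> A \<le> smeas \<nu> P" by (rule LIMSEQ_le_const) (use ge in auto)
  moreover have "P \<subseteq> A" unfolding P_def using B0 by auto
  moreover have "positive_set \<nu> P"
    unfolding positive_set_def
  proof (intro conjI ballI impI Ps)
    fix C :: "real set" assume C: "C \<in> sets borel" "C \<subseteq> P"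
    have le: "- (1 / real (Suc n)) \<le> smeas \<nu> C" for n
      using f[OF Bs[of n], of n] C unfolding BS[symmetric] P_def by (meson INF_lower UNIV_I less_imp_le order_trans)
    have "(\<lambda>n. - (1 / real (Suc n))) \<longlonglongrightarrow> - 0"
      by (intro tendsto_minus LIMSEQ_Suc lim_1_over_n)
    then show "0 \<le> smeas \<nu> C" using LIMSEQ_le_const2[of _ "- 0" "smeas \<nu> C"] le by auto
  qed
  ultimately show ?thesis by auto
qed

lemma positive_set_UN:
  assumes P: "\<And>n::nat. positive_set \<nu> (P n)"
  shows "positive_set \<nu> (\<Union>n. P n)"
  unfolding positive_set_def
proof (intro conjI ballI impI)
  have Ps: "P n \<in> sets borel" for n using P by (auto simp: positive_set_def)
  then show "(\<Union>n. P n) \<in> sets borel" by auto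
  fix B :: "real set" assume B: "B \<in> sets borel" "B \<subseteq> (\<Union>n. P n)"
  have d: "disjointed P n \<in> sets borel" for n
    using sets.range_disjointed_sets[of P borel] Ps by auto
  have "disjoint_family (\<lambda>n. B \<inter> disjointed P n)"
    using disjoint_family_disjointed[of P] unfolding disjoint_family_on_def by blast
  then have "(\<lambda>n. smeas \<nu> (B \<inter> disjointed P n)) sums smeas \<nu> (\<Union>n. B \<inter> disjointed P n)"
    using B d by (intro smeas_sums) auto
  moreover have "(\<Union>n. B \<inter> disjointed P n) = B"
    using B UN_disjointed_eq[of P] by auto
  moreover have "0 \<le> smeas \<nu> (B \<inter> disjointed P n)" for n
    using P[of n] B d[of n] disjointed_subset[of P n] unfolding positive_set_def
    by (meson inf.coboundedI2 sets.Int)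
  ultimately have "(\<lambda>n. smeas \<nu> (B \<inter> disjointed P n)) sums smeas \<nu> B"
    and ge: "0 \<le> smeas \<nu> (B \<inter> disjointed P n)" for n by simp_all
  from sums_le[OF ge sums_zero this(1)] show "0 \<le> smeas \<nu> B" .
qed

lemma positive_set_Un:
  assumes "positive_set \<nu> P" "positive_set \<nu> Q"
  shows "positive_set \<nu> (P \<union> Q)"
proof -
  have "positive_set \<nu> (\<Union>n. binaryset P Q n)"
  proof (rule positive_set_UN)
    fix n show "positive_set \<nu> (binaryset P Q n)"
      using assms by (auto simp: binaryset_def positive_set_def)
  qed
  then show ?thesis by (simp add: UN_binaryset_eq)
qed

lemma positive_set_mono:
  assumes "positive_set \<nu> Q" "P \<in> sets borel" "P \<subseteq> Q"
  shows "smeas \<nu> P \<le> smeas \<nu> Q"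
proof -
  have "0 \<le> smeas \<nu> (Q - P)" using assms by (auto simp: positive_set_def)
  with assms show ?thesis by (simp add: smeas_Diff positive_set_def)
qed

lemma Hahn_decomposition:
  obtains P where "P \<in> sets borel"
    "\<And>A. A \<in> sets borel \<Longrightarrow> A \<subseteq> P \<Longrightarrow> 0 \<le> smeas \<nu> A"
    "\<And>A. A \<in> sets borel \<Longrightarrow> A \<inter> P = {} \<Longrightarrow> smeas \<nu> A \<le> 0"
proof -
  define S where "S = smeas \<nu> ` {P. positive_set \<nu> P}"
  have "positive_set \<nu> {}" by (auto simp: positive_set_def)
  then have ne: "S \<noteq> {}" by (auto simp: S_def)
  have bdd: "bdd_above S"
  proof (rule ccontr)
    assume "\<not> bdd_above S"
    then have "\<forall>n. \<exists>P. positive_set \<nu> P \<and> real n < smeas \<nu> P"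
      unfolding bdd_above_def S_def by (auto simp: not_le)
    then obtain P where P: "\<And>n. positive_set \<nu> (P n)" "\<And>n. real n < smeas \<nu> (P n)" by metis
    have "smeas \<nu> (P n) \<le> smeas \<nu> (\<Union>n. P n)" for n
      using P by (intro positive_set_mono positive_set_UN) (auto simp: positive_set_def)
    with P(2) have "real n < smeas \<nu> (\<Union>n. P n)" for n by (meson less_le_trans)
    then show False using reals_Archimedean2[of "smeas \<nu> (\<Union>n. P n)"] less_asym by blast
  qed
  have "\<forall>n. \<exists>P. positive_set \<nu> P \<and> Sup S - 1 / real (Suc n) < smeas \<nu> P"
  proof
    fix n
    have "Sup S - 1 / real (Suc n) < Sup S" by simp
    then obtain s where "s \<in> S" "Sup S - 1 / real (Suc n) < s"
      by (rule less_cSupE[OF _ ne])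
    then show "\<exists>P. positive_set \<nu> P \<and> Sup S - 1 / real (Suc n) < smeas \<nu> P"
      by (auto simp: S_def simp del: of_nat_Suc)
  qed
  then obtain P where P: "\<And>n. positive_set \<nu> (P n)" "\<And>n. Sup S - 1 / real (Suc n) < smeas \<nu> (P n)" by metis
  define H where "H = (\<Union>n. P n)"
  have H: "positive_set \<nu> H" unfolding H_def by (rule positive_set_UN) (rule P)
  have "smeas \<nu> (P n) \<le> smeas \<nu> H" for n
    by (rule positive_set_mono[OF H]) (use P in \<open>auto simp: positive_set_def H_def\<close>)
  with P(2) have "Sup S - 1 / real (Suc n) \<le> smeas \<nu> H" for n by (meson less_imp_le order_trans)
  moreover have "(\<lambda>n. Sup S - 1 / real (Suc n)) \<longlonglongrightarrow> Sup S - 0"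
    by (intro tendsto_diff tendsto_const LIMSEQ_Suc lim_1_over_n)
  ultimately have top: "Sup S \<le> smeas \<nu> H" using LIMSEQ_le_const2[of _ "Sup S - 0"] by auto
  show thesis
  proof (rule that)
    show "H \<in> sets borel" using H by (simp add: positive_set_def)
    show "0 \<le> smeas \<nu> A" if "A \<in> sets borel" "A \<subseteq> H" for A using H that by (simp add: positive_set_def)
    show "smeas \<nu> A \<le> 0" if A: "A \<in> sets borel" "A \<inter> H = {}" for A
    proof (rule ccontr)
      assume "\<not> smeas \<nu> A \<le> 0"
      moreover obtain Q where Q: "positive_set \<nu> Q" "Q \<subseteq> A" "smeas \<nu> A \<le> smeas \<nu> Q"
        using positive_subset[OF A(1)] by blast
      moreover have "smeas \<nu> (H \<union> Q) = smeas \<nu> H + smeas \<nu> Q"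
        using A Q H by (intro smeas_Un) (auto simp: positive_set_def)
      ultimately have "Sup S < smeas \<nu> (H \<union> Q)" using top by simp
      moreover have "smeas \<nu> (H \<union> Q) \<le> Sup S"
        by (intro cSup_upper bdd) (use positive_set_Un[OF H Q(1)] in \<open>auto simp: S_def\<close>)
      ultimately show False by simp
    qed
  qed
qed

instantiation smeasure :: real_vector
begin

lift_definition zero_smeasure :: smeasure is "\<lambda>_. 0" by simp

lift_definition plus_smeasure :: "smeasure \<Rightarrow> smeasure \<Rightarrow> smeasure" is "\<lambda>\<mu> \<nu> A. \<mu> A + \<nu> A"
  by (intro conjI allI impI ballI sums_add; simp)

lift_definition minus_smeasure :: "smeasure \<Rightarrow> smeasure \<Rightarrow> smeasure" is "\<lambda>\<mu> \<nu> A. \<mu> A - \<nu> A"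
  by (intro conjI allI impI ballI sums_diff; simp)

lift_definition uminus_smeasure :: "smeasure \<Rightarrow> smeasure" is "\<lambda>\<mu> A. - \<mu> A"
  by (intro conjI allI impI ballI sums_minus; simp)

lift_definition scaleR_smeasure :: "real \<Rightarrow> smeasure \<Rightarrow> smeasure" is "\<lambda>c \<mu> A. c * \<mu> A"
  by (intro conjI allI impI ballI sums_mult; simp)

instance
  by standard
    (rule smeasure_eqI; simp add: zero_smeasure.rep_eq plus_smeasure.rep_eq minus_smeasure.rep_eq
      uminus_smeasure.rep_eq scaleR_smeasure.rep_eq algebra_simps)+

end

lemma smeas_zero [simp]: "smeas 0 A = 0" by (simp add: zero_smeasure.rep_eq)
lemma smeas_add [simp]: "smeas (\<mu> + \<nu>) A = smeas \<mu> A + smeas \<nu> A" by (simp add: plus_smeasure.rep_eq)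
lemma smeas_minus [simp]: "smeas (\<mu> - \<nu>) A = smeas \<mu> A - smeas \<nu> A" by (simp add: minus_smeasure.rep_eq)
lemma smeas_uminus [simp]: "smeas (- \<mu>) A = - smeas \<mu> A" by (simp add: uminus_smeasure.rep_eq)
lemma smeas_scaleR [simp]: "smeas (c *\<^sub>R \<mu>) A = c * smeas \<mu> A" by (simp add: scaleR_smeasure.rep_eq)

lemma smeas_sum: "smeas (\<Sum>i\<in>I. f i) A = (\<Sum>i\<in>I. smeas (f i) A)"
  by (induction I rule: infinite_finite_induct) auto

text \<open>The norm is the total variation: the supremum of \<open>\<Sum>\<bar>\<nu> A\<bar>\<close> over finite families of disjoint Borel sets.\<close>

definition borel_families :: "real set set set" where
  "borel_families = {\<P>. finite \<P> \<and> disjoint \<P> \<and> \<P> \<subseteq> sets borel}"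

lemma smeas_Union:
  assumes "\<P> \<in> borel_families"
  shows "smeas \<nu> (\<Union>\<P>) = (\<Sum>A\<in>\<P>. smeas \<nu> A)"
proof -
  have "smeas \<nu> (\<Union>A\<in>\<P>. A) = (\<Sum>A\<in>\<P>. smeas \<nu> A)"
    using assms by (intro smeas_finite_UN) (auto simp: borel_families_def disjoint_family_on_def disjoint_def)
  then show ?thesis by simp
qed

lemma borel_family_single: "A \<in> sets borel \<Longrightarrow> {A} \<in> borel_families"
  by (auto simp: borel_families_def disjoint_def)

lemma variation_bdd: "bdd_above ((\<lambda>\<P>. \<Sum>A\<in>\<P>. \<bar>smeas \<nu> A\<bar>) ` borel_families)"
proof -
  obtain P where P: "P \<in> sets borel"
    "\<And>A. A \<in> sets borel \<Longrightarrow> A \<subseteq> P \<Longrightarrow> 0 \<le> smeas \<nu> A"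
    "\<And>A. A \<in> sets borel \<Longrightarrow> A \<inter> P = {} \<Longrightarrow> smeas \<nu> A \<le> 0"
    using Hahn_decomposition[of \<nu>] by blast
  have "(\<Sum>A\<in>\<P>. \<bar>smeas \<nu> A\<bar>) \<le> smeas \<nu> P - smeas \<nu> (- P)" if p: "\<P> \<in> borel_families" for \<P>
  proof -
    have fin: "finite \<P>" and b: "\<And>A. A \<in> \<P> \<Longrightarrow> A \<in> sets borel" and U: "\<Union>\<P> \<in> sets borel"
      and d: "disjoint_family_on (\<lambda>A. A \<inter> X) \<P>" for X
      using p by (auto simp: borel_families_def disjoint_family_on_def disjoint_def)
    have "\<bar>smeas \<nu> A\<bar> \<le> smeas \<nu> (A \<inter> P) - smeas \<nu> (A \<inter> - P)" if "A \<in> \<P>" for A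
    proof -
      have "smeas \<nu> ((A \<inter> P) \<union> (A \<inter> - P)) = smeas \<nu> (A \<inter> P) + smeas \<nu> (A \<inter> - P)"
        using b[OF that] P(1) by (intro smeas_Un) auto
      moreover have "(A \<inter> P) \<union> (A \<inter> - P) = A" by auto
      moreover have "0 \<le> smeas \<nu> (A \<inter> P)" "smeas \<nu> (A \<inter> - P) \<le> 0"
        using b[OF that] P(1) by (auto intro!: P)
      ultimately show ?thesis by auto
    qed
    then have "(\<Sum>A\<in>\<P>. \<bar>smeas \<nu> A\<bar>) \<le> (\<Sum>A\<in>\<P>. smeas \<nu> (A \<inter> P) - smeas \<nu> (A \<inter> - P))"
      by (rule sum_mono)
    also have "\<dots> = smeas \<nu> (\<Union>A\<in>\<P>. A \<inter> P) - smeas \<nu> (\<Union>A\<in>\<P>. A \<inter> - P)"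
      using fin b P(1) d
        smeas_finite_UN[of \<P> "\<lambda>A. A \<inter> P" \<nu>] smeas_finite_UN[of \<P> "\<lambda>A. A \<inter> - P" \<nu>]
      by (simp add: sum_subtractf del: UN_simps)
    finally have "(\<Sum>A\<in>\<P>. \<bar>smeas \<nu> A\<bar>) \<le> smeas \<nu> (\<Union>A\<in>\<P>. A \<inter> P) - smeas \<nu> (\<Union>A\<in>\<P>. A \<inter> - P)" .
    moreover have "smeas \<nu> (\<Union>A\<in>\<P>. A \<inter> P) \<le> smeas \<nu> P"
      using P U b fin by (intro positive_set_mono[of \<nu> P]) (auto simp: positive_set_def)
    moreover have "- smeas \<nu> (\<Union>A\<in>\<P>. A \<inter> - P) \<le> - smeas \<nu> (- P)"
    proof -
      have "smeas (- \<nu>) (\<Union>A\<in>\<P>. A \<inter> - P) \<le> smeas (- \<nu>) (- P)"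
        using P U b fin by (intro positive_set_mono[of "- \<nu>"]) (auto simp: positive_set_def)
      then show ?thesis by simp
    qed
    ultimately show ?thesis by linarith
  qed
  then show ?thesis by (intro bdd_aboveI2)
qed

lemma borel_families_nonempty: "borel_families \<noteq> {}"
  using borel_family_single[of "{}"] by auto

instantiation smeasure :: real_normed_vector
begin

definition norm_smeasure :: "smeasure \<Rightarrow> real" where
  "norm_smeasure \<nu> = (SUP \<P>\<in>borel_families. \<Sum>A\<in>\<P>. \<bar>smeas \<nu> A\<bar>)"

definition dist_smeasure :: "smeasure \<Rightarrow> smeasure \<Rightarrow> real" where
  "dist_smeasure \<mu> \<nu> = norm (\<mu> - \<nu>)"

definition sgn_smeasure :: "smeasure \<Rightarrow> smeasure" where
  "sgn_smeasure \<nu> = inverse (norm \<nu>) *\<^sub>R \<nu>"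

definition uniformity_smeasure :: "(smeasure \<times> smeasure) filter" where
  "uniformity_smeasure = (INF e\<in>{0 <..}. principal {(\<mu>, \<nu>). dist \<mu> (\<nu> :: smeasure) < e})"

definition open_smeasure :: "smeasure set \<Rightarrow> bool" where
  "open_smeasure U \<longleftrightarrow> (\<forall>\<mu>\<in>U. \<forall>\<^sub>F (\<mu>', \<nu>) in uniformity. \<mu>' = \<mu> \<longrightarrow> \<nu> \<in> U)"

instance
proof
  have upper: "(\<Sum>A\<in>\<P>. \<bar>smeas \<nu> A\<bar>) \<le> norm \<nu>" if "\<P> \<in> borel_families" for \<nu> \<P>
    unfolding norm_smeasure_def using that by (intro cSUP_upper variation_bdd)
  have least: "norm \<nu> \<le> c" if "\<And>\<P>. \<P> \<in> borel_families \<Longrightarrow> (\<Sum>A\<in>\<P>. \<bar>smeas \<nu> A\<bar>) \<le> c" for \<nu> c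
    unfolding norm_smeasure_def using that by (intro cSUP_least borel_families_nonempty)
  have smeas_le: "\<bar>smeas \<nu> A\<bar> \<le> norm \<nu>" if "A \<in> sets borel" for \<nu> A
    using upper[OF borel_family_single[OF that]] by simp
  fix \<mu> \<nu> :: smeasure and c :: real
  show "dist \<mu> \<nu> = norm (\<mu> - \<nu>)" by (rule dist_smeasure_def)
  show "sgn \<nu> = inverse (norm \<nu>) *\<^sub>R \<nu>" by (rule sgn_smeasure_def)
  show "uniformity = (INF e\<in>{0 <..}. principal {(\<mu>, \<nu>). dist \<mu> (\<nu> :: smeasure) < e})"
    by (rule uniformity_smeasure_def)
  show "open U \<longleftrightarrow> (\<forall>\<mu>\<in>U. \<forall>\<^sub>F (\<mu>', \<nu>) in uniformity. \<mu>' = \<mu> \<longrightarrow> \<nu> \<in> U)" for U :: "smeasure set"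
    by (rule open_smeasure_def)
  show "(norm \<nu> = 0) = (\<nu> = 0)"
  proof
    assume "norm \<nu> = 0"
    with smeas_le[of _ \<nu>] show "\<nu> = 0" by (intro smeasure_eqI) auto
  next
    assume "\<nu> = 0"
    then have "norm \<nu> \<le> 0" by (intro least) simp
    moreover have "0 \<le> norm \<nu>" using smeas_le[of "{}" \<nu>] by simp
    ultimately show "norm \<nu> = 0" by simp
  qed
  show "norm (\<mu> + \<nu>) \<le> norm \<mu> + norm \<nu>"
  proof (rule least)
    fix \<P> assume p: "\<P> \<in> borel_families"
    have "(\<Sum>A\<in>\<P>. \<bar>smeas (\<mu> + \<nu>) A\<bar>) \<le> (\<Sum>A\<in>\<P>. \<bar>smeas \<mu> A\<bar> + \<bar>smeas \<nu> A\<bar>)"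
      by (intro sum_mono) (simp add: abs_triangle_ineq)
    also have "\<dots> \<le> norm \<mu> + norm \<nu>" using upper[OF p] by (simp add: sum.distrib add_mono)
    finally show "(\<Sum>A\<in>\<P>. \<bar>smeas (\<mu> + \<nu>) A\<bar>) \<le> norm \<mu> + norm \<nu>" .
  qed
  have scale: "norm (c *\<^sub>R \<nu>) \<le> \<bar>c\<bar> * norm \<nu>" for c and \<nu> :: smeasure
  proof (rule least)
    fix \<P> assume p: "\<P> \<in> borel_families"
    have "(\<Sum>A\<in>\<P>. \<bar>smeas (c *\<^sub>R \<nu>) A\<bar>) = \<bar>c\<bar> * (\<Sum>A\<in>\<P>. \<bar>smeas \<nu> A\<bar>)"
      by (simp add: abs_mult sum_distrib_left)
    also have "\<dots> \<le> \<bar>c\<bar> * norm \<nu>" by (intro mult_left_mono upper[OF p]) simp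
    finally show "(\<Sum>A\<in>\<P>. \<bar>smeas (c *\<^sub>R \<nu>) A\<bar>) \<le> \<bar>c\<bar> * norm \<nu>" .
  qed
  show "norm (c *\<^sub>R \<nu>) = \<bar>c\<bar> * norm \<nu>"
  proof (rule antisym[OF scale])
    show "\<bar>c\<bar> * norm \<nu> \<le> norm (c *\<^sub>R \<nu>)"
    proof (cases "c = 0")
      case True
      then show ?thesis using smeas_le[of "{}" "c *\<^sub>R \<nu>"] by simp
    next
      case False
      have "norm \<nu> \<le> \<bar>inverse c\<bar> * norm (c *\<^sub>R \<nu>)"
        using scale[of "inverse c" "c *\<^sub>R \<nu>"] False by simp
      with False show ?thesis
        by (simp add: field_simps)
    qed
  qed
qed

end

lemma variation_le_norm: "\<P> \<in> borel_families \<Longrightarrow> (\<Sum>A\<in>\<P>. \<bar>smeas \<nu> A\<bar>) \<le> norm \<nu>"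
  unfolding norm_smeasure_def by (intro cSUP_upper variation_bdd)

lemma norm_smeasure_leI:
  "(\<And>\<P>. \<P> \<in> borel_families \<Longrightarrow> (\<Sum>A\<in>\<P>. \<bar>smeas \<nu> A\<bar>) \<le> c) \<Longrightarrow> norm \<nu> \<le> c"
  unfolding norm_smeasure_def by (intro cSUP_least borel_families_nonempty)

lemma smeas_le_norm: "\<bar>smeas \<nu> A\<bar> \<le> norm \<nu>"
  using variation_le_norm[OF borel_family_single, of A \<nu>]
  by (cases "A \<in> sets borel") (auto simp: smeas_not_borel)

lemma bounded_linear_smeas: "bounded_linear (\<lambda>\<nu>. smeas \<nu> A)"
  by (rule bounded_linear_intro[of _ 1]) (auto simp: smeas_le_norm)

instance smeasure :: banach
proof
  fix X :: "nat \<Rightarrow> smeasure"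
  assume X: "Cauchy X"
  define L where "L A = lim (\<lambda>n. smeas (X n) A)" for A
  have lim: "(\<lambda>n. smeas (X n) A) \<longlonglongrightarrow> L A" for A
    unfolding L_def using bounded_linear.Cauchy[OF bounded_linear_smeas X]
    by (simp add: Cauchy_convergent_iff convergent_LIMSEQ_iff)
  have close: "\<exists>N. \<forall>n\<ge>N. \<forall>A. \<bar>smeas (X n) A - L A\<bar> \<le> e" if e: "0 < e" for e
  proof -
    obtain N where N: "\<And>m n. m \<ge> N \<Longrightarrow> n \<ge> N \<Longrightarrow> norm (X m - X n) < e"
      using CauchyD[OF X e] by blast
    have "\<bar>smeas (X n) A - L A\<bar> \<le> e" if n: "n \<ge> N" for n A
    proof (rule LIMSEQ_le_const2)
      show "(\<lambda>m. \<bar>smeas (X n) A - smeas (X m) A\<bar>) \<longlonglongrightarrow> \<bar>smeas (X n) A - L A\<bar>"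
        by (intro tendsto_intros lim)
      have "\<bar>smeas (X n) A - smeas (X m) A\<bar> \<le> e" if "m \<ge> N" for m
        using smeas_le_norm[of "X n - X m" A] N[OF n that] by simp
      then show "\<exists>N. \<forall>m\<ge>N. \<bar>smeas (X n) A - smeas (X m) A\<bar> \<le> e" by blast
    qed
    then show ?thesis by blast
  qed
  have "(\<lambda>n. L (A n)) sums L (\<Union>n. A n)" if A: "range A \<subseteq> sets borel" "disjoint_family A" for A :: "nat \<Rightarrow> real set"
  proof -
    have part: "smeas (X n) (\<Union>i. A i) - (\<Sum>i<k. smeas (X n) (A i)) = smeas (X n) (\<Union>i\<in>{k..}. A i)" for n k
    proof -
      have "smeas (X n) (\<Union>i<k. A i) = (\<Sum>i<k. smeas (X n) (A i))"
        using A by (intro smeas_finite_UN) (auto simp: disjoint_family_on_def)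
      moreover have "smeas (X n) ((\<Union>i<k. A i) \<union> (\<Union>i\<in>{k..}. A i)) = smeas (X n) (\<Union>i<k. A i) + smeas (X n) (\<Union>i\<in>{k..}. A i)"
        using A by (intro smeas_Un) (auto simp: disjoint_family_on_def, metis disjoint_iff leD)
      moreover have "(\<Union>i<k. A i) \<union> (\<Union>i\<in>{k..}. A i) = (\<Union>i. A i)"
        by (auto, metis atLeast_iff lessThan_iff not_less)
      ultimately show ?thesis by simp
    qed
    have partL: "L (\<Union>i. A i) - (\<Sum>i<k. L (A i)) = L (\<Union>i\<in>{k..}. A i)" for k
    proof (rule LIMSEQ_unique)
      show "(\<lambda>n. smeas (X n) (\<Union>i. A i) - (\<Sum>i<k. smeas (X n) (A i))) \<longlonglongrightarrow> L (\<Union>i. A i) - (\<Sum>i<k. L (A i))"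
        by (intro tendsto_diff tendsto_sum lim)
      show "(\<lambda>n. smeas (X n) (\<Union>i. A i) - (\<Sum>i<k. smeas (X n) (A i))) \<longlonglongrightarrow> L (\<Union>i\<in>{k..}. A i)"
        unfolding part by (rule lim)
    qed
    have "(\<lambda>k. (\<Sum>i<k. L (A i))) \<longlonglongrightarrow> L (\<Union>n. A n)"
    proof (rule LIMSEQ_I)
      fix r :: real assume r: "0 < r"
      obtain n where n: "\<And>A. \<bar>smeas (X n) A - L A\<bar> \<le> r/2" using close[of "r/2"] r by auto
      have "(\<lambda>k. \<Sum>i<k. smeas (X n) (A i)) \<longlonglongrightarrow> smeas (X n) (\<Union>i. A i)"
        using smeas_sums[OF A] by (simp add: sums_def)
      then obtain k0 where k0: "\<And>k. k \<ge> k0 \<Longrightarrow> \<bar>(\<Sum>i<k. smeas (X n) (A i)) - smeas (X n) (\<Union>i. A i)\<bar> < r/2"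
        using LIMSEQ_D[of _ _ "r/2"] r by (metis half_gt_zero real_norm_def)
      have "norm ((\<Sum>i<k. L (A i)) - L (\<Union>n. A n)) < r" if "k \<ge> k0" for k
        using k0[OF that] n[of "\<Union>i\<in>{k..}. A i"] part[of n k] partL[of k] unfolding real_norm_def by linarith
      then show "\<exists>k0. \<forall>k\<ge>k0. norm ((\<Sum>i<k. L (A i)) - L (\<Union>n. A n)) < r" by blast
    qed
    then show ?thesis by (simp add: sums_def)
  qed
  moreover have "L A = 0" if "A \<inter> {0..} = {} \<or> A \<notin> sets borel" for A
    unfolding L_def using that by (auto simp: smeas_not_borel smeas_outside)
  ultimately have L: "smeas (Abs_smeasure L) = L"
    by (intro Abs_smeasure_inverse) auto
  have "X \<longlonglongrightarrow> Abs_smeasure L"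
  proof (rule LIMSEQ_I)
    fix r :: real assume r: "0 < r"
    obtain N where N: "\<And>m n. m \<ge> N \<Longrightarrow> n \<ge> N \<Longrightarrow> norm (X m - X n) < r/2"
      using CauchyD[OF X, of "r/2"] r by auto
    have le: "norm (X n - Abs_smeasure L) \<le> r/2" if n: "n \<ge> N" for n
    proof (rule norm_smeasure_leI, rule LIMSEQ_le_const2)
      fix \<P> assume p: "\<P> \<in> borel_families"
      show "(\<lambda>m. \<Sum>A\<in>\<P>. \<bar>smeas (X n - X m) A\<bar>) \<longlonglongrightarrow> (\<Sum>A\<in>\<P>. \<bar>smeas (X n - Abs_smeasure L) A\<bar>)"
        unfolding smeas_minus L by (intro tendsto_intros lim)
      have "(\<Sum>A\<in>\<P>. \<bar>smeas (X n - X m) A\<bar>) \<le> r/2" if "m \<ge> N" for m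
        using variation_le_norm[OF p, of "X n - X m"] N[OF n that] by simp
      then show "\<exists>N. \<forall>m\<ge>N. (\<Sum>A\<in>\<P>. \<bar>smeas (X n - X m) A\<bar>) \<le> r/2" by blast
    qed
    have "norm (X n - Abs_smeasure L) < r" if "n \<ge> N" for n
      using le[OF that] r by linarith
    then show "\<exists>N. \<forall>n\<ge>N. norm (X n - Abs_smeasure L) < r" by blast
  qed
  then show "convergent X" by (auto simp: convergent_def)
qed

text \<open>Upper variation of \<open>\<nu>\<close>, i.e. the positive part of its Jordan decomposition
  (see \<open>smeas_Jordan\<close>).\<close>

definition pos_part :: "smeasure \<Rightarrow> real measure" where
  "pos_part \<nu> = measure_of UNIV (sets borel) (\<lambda>A. ennreal (SUP B\<in>{B \<in> sets borel. B \<subseteq> A}. smeas \<nu> B))"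

definition neg_part :: "smeasure \<Rightarrow> real measure" where
  "neg_part \<nu> = pos_part (- \<nu>)"

definition sintegral :: "smeasure \<Rightarrow> (real \<Rightarrow> real) \<Rightarrow> real" where
  "sintegral \<nu> f = (LINT x|pos_part \<nu>. f x) - (LINT x|neg_part \<nu>. f x)"

text \<open>Product of \<open>\<nu>\<close> with the function \<open>f\<close>; meaningful when \<open>f\<close> is integrable with respect to \<open>\<bar>\<nu>\<bar>\<close>,
  see \<open>smeas_sdensity\<close>.\<close>

definition sdensity :: "(real \<Rightarrow> real) \<Rightarrow> smeasure \<Rightarrow> smeasure" where
  "sdensity f \<nu> = Abs_smeasure (\<lambda>A. if A \<in> sets borel then sintegral \<nu> (\<lambda>x. f x * indicator A x) else 0)"

text \<open>Push-forward of the product measure under multiplication; \<open>mellin_conv_characterization\<close> below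
  identifies it with the measure defined through continuous test functions.\<close>

definition mellin_conv :: "smeasure \<Rightarrow> smeasure \<Rightarrow> smeasure" where
  "mellin_conv \<mu> \<nu> = Abs_smeasure (\<lambda>A. if A \<in> sets borel
     then sintegral \<nu> (\<lambda>y. sintegral \<mu> (\<lambda>x. indicator A (x * y))) else 0)"

definition Hahn_set :: "smeasure \<Rightarrow> real set \<Rightarrow> bool" where
  "Hahn_set \<nu> P \<longleftrightarrow> positive_set \<nu> P \<and> positive_set (- \<nu>) (- P)"

lemma Hahn_setD:
  assumes "Hahn_set \<nu> P"
  shows "P \<in> sets borel"
    "\<And>A. A \<in> sets borel \<Longrightarrow> A \<subseteq> P \<Longrightarrow> 0 \<le> smeas \<nu> A"
    "\<And>A. A \<in> sets borel \<Longrightarrow> A \<inter> P = {} \<Longrightarrow> smeas \<nu> A \<le> 0"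
  using assms by (auto simp: Hahn_set_def positive_set_def disjoint_eq_subset_Compl)

lemma Hahn_set_uminus: "Hahn_set \<nu> P \<Longrightarrow> Hahn_set (- \<nu>) (- P)"
  by (simp add: Hahn_set_def)

lemma Hahn_set_exists: "\<exists>P. Hahn_set \<nu> P"
proof -
  obtain P where "P \<in> sets borel"
    "\<And>A. A \<in> sets borel \<Longrightarrow> A \<subseteq> P \<Longrightarrow> 0 \<le> smeas \<nu> A"
    "\<And>A. A \<in> sets borel \<Longrightarrow> A \<inter> P = {} \<Longrightarrow> smeas \<nu> A \<le> 0"
    using Hahn_decomposition[of \<nu>] by blast
  then show ?thesis
    by (auto simp: Hahn_set_def positive_set_def disjoint_eq_subset_Compl)
qed

lemma Hahn_SUP:
  assumes H: "Hahn_set \<nu> P" and A: "A \<in> sets borel"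
  shows "(SUP B\<in>{B \<in> sets borel. B \<subseteq> A}. smeas \<nu> B) = smeas \<nu> (A \<inter> P)"
proof (rule cSup_eq_maximum)
  note P = Hahn_setD[OF H]
  show "smeas \<nu> (A \<inter> P) \<in> smeas \<nu> ` {B \<in> sets borel. B \<subseteq> A}" using A P(1) by auto
  fix y assume "y \<in> smeas \<nu> ` {B \<in> sets borel. B \<subseteq> A}"
  then obtain B where B: "B \<in> sets borel" "B \<subseteq> A" "y = smeas \<nu> B" by auto
  have "smeas \<nu> ((B \<inter> P) \<union> (B - P)) = smeas \<nu> (B \<inter> P) + smeas \<nu> (B - P)"
    using B(1) P(1) by (intro smeas_Un) auto
  moreover have "(B \<inter> P) \<union> (B - P) = B" by auto
  moreover have "smeas \<nu> (B - P) \<le> 0" using B(1) P(1) by (intro P(3)) auto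
  moreover have "smeas \<nu> (B \<inter> P) \<le> smeas \<nu> (A \<inter> P)"
    using A B P(1) positive_set_mono[of \<nu> "A \<inter> P" "B \<inter> P"] P(2)
    by (auto simp: positive_set_def)
  ultimately show "y \<le> smeas \<nu> (A \<inter> P)" using B(3) by simp
qed

lemma sets_pos_part [simp, measurable_cong]: "sets (pos_part \<nu>) = sets borel"
  unfolding pos_part_def using sets.sigma_sets_eq[of "borel :: real measure"] by simp

lemma space_pos_part [simp]: "space (pos_part \<nu>) = UNIV"
  using sets_eq_imp_space_eq[OF sets_pos_part] by simp

lemma sets_neg_part [simp, measurable_cong]: "sets (neg_part \<nu>) = sets borel"
  by (simp add: neg_part_def)

lemma space_neg_part [simp]: "space (neg_part \<nu>) = UNIV"
  by (simp add: neg_part_def)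

lemma emeasure_pos_part_Hahn:
  assumes H: "Hahn_set \<nu> P" and A: "A \<in> sets borel"
  shows "emeasure (pos_part \<nu>) A = ennreal (smeas \<nu> (A \<inter> P))"
proof -
  note P = Hahn_setD[OF H]
  let ?m = "\<lambda>A. ennreal (SUP B\<in>{B \<in> sets borel. B \<subseteq> A}. smeas \<nu> B)"
  have m: "?m A = ennreal (smeas \<nu> (A \<inter> P))" if "A \<in> sets borel" for A
    using Hahn_SUP[OF H that] by simp
  have "emeasure (measure_of UNIV (sets borel) ?m) A = ?m A"
  proof (rule emeasure_measure_of_sigma)
    show "sigma_algebra UNIV (sets (borel :: real measure))"
      using sets.sigma_algebra_axioms[of "borel :: real measure"] by simp
    show "positive (sets borel) ?m" by (simp add: positive_def m)
    show "countably_additive (sets borel) ?m"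
    proof (rule countably_additiveI)
      fix F :: "nat \<Rightarrow> real set"
      assume F: "range F \<subseteq> sets borel" "disjoint_family F" "(\<Union>i. F i) \<in> sets borel"
      have d: "disjoint_family (\<lambda>i. F i \<inter> P)" using F(2) unfolding disjoint_family_on_def by blast
      have Fs: "F i \<in> sets borel" for i using F(1) by auto
      have s: "(\<lambda>i. smeas \<nu> (F i \<inter> P)) sums smeas \<nu> (\<Union>i. F i \<inter> P)"
        using Fs P(1) d by (intro smeas_sums) auto
      have nn: "0 \<le> smeas \<nu> (F i \<inter> P)" for i using Fs P(1) by (intro P(2)) auto
      have "(\<Sum>i. ?m (F i)) = (\<Sum>i. ennreal (smeas \<nu> (F i \<inter> P)))" using m Fs by simp
      also have "\<dots> = ennreal (\<Sum>i. smeas \<nu> (F i \<inter> P))"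
        by (rule suminf_ennreal2) (use nn s in \<open>auto simp: sums_iff\<close>)
      also have "(\<Sum>i. smeas \<nu> (F i \<inter> P)) = smeas \<nu> ((\<Union>i. F i) \<inter> P)"
        using s by (simp add: sums_iff)
      finally show "(\<Sum>i. ?m (F i)) = ?m (\<Union>i. F i)" using m[OF F(3)] by simp
    qed
  qed (rule A)
  then show ?thesis by (simp add: pos_part_def m[OF A])
qed

lemma Jordan:
  shows finite_pos_part: "finite_measure (pos_part \<nu>)"
    and finite_neg_part: "finite_measure (neg_part \<nu>)"
    and smeas_Jordan: "smeas \<nu> A = measure (pos_part \<nu>) A - measure (neg_part \<nu>) A"
proof -
  obtain P where H: "Hahn_set \<nu> P" using Hahn_set_exists by blast
  note P = Hahn_setD[OF H]
  note Q = Hahn_setD[OF Hahn_set_uminus[OF H]]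
  have e: "emeasure (pos_part \<nu>) A = ennreal (smeas \<nu> (A \<inter> P))"
     "emeasure (neg_part \<nu>) A = ennreal (- smeas \<nu> (A \<inter> - P))" if "A \<in> sets borel" for A
    using emeasure_pos_part_Hahn[OF H that] emeasure_pos_part_Hahn[OF Hahn_set_uminus[OF H] that]
    by (simp_all add: neg_part_def)
  show "finite_measure (pos_part \<nu>)" "finite_measure (neg_part \<nu>)"
    by (auto intro!: finite_measureI simp: e)
  show "smeas \<nu> A = measure (pos_part \<nu>) A - measure (neg_part \<nu>) A"
  proof (cases "A \<in> sets borel")
    case True
    have "smeas \<nu> ((A \<inter> P) \<union> (A \<inter> - P)) = smeas \<nu> (A \<inter> P) + smeas \<nu> (A \<inter> - P)"
      using True P(1) by (intro smeas_Un) auto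
    moreover have "(A \<inter> P) \<union> (A \<inter> - P) = A" by auto
    moreover have "0 \<le> smeas \<nu> (A \<inter> P)" "0 \<le> - smeas \<nu> (A \<inter> - P)"
      using P(2)[of "A \<inter> P"] Q(2)[of "A \<inter> - P"] True P(1) by auto
    ultimately show ?thesis using e[OF True] by (simp add: measure_def)
  next
    case False
    then show ?thesis by (simp add: smeas_not_borel measure_notin_sets)
  qed
qed

lemma pos_part_least:
  assumes "finite_measure M" "sets M = sets borel" "A \<in> sets borel"
    and le: "\<And>B. B \<in> sets borel \<Longrightarrow> smeas \<nu> B \<le> measure M B"
  shows "emeasure (pos_part \<nu>) A \<le> emeasure M A"
proof -
  interpret finite_measure M by fact
  obtain P where H: "Hahn_set \<nu> P" using Hahn_set_exists by blast
  note P = Hahn_setD[OF H]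
  have "emeasure (pos_part \<nu>) A = ennreal (smeas \<nu> (A \<inter> P))"
    by (rule emeasure_pos_part_Hahn[OF H assms(3)])
  also have "\<dots> \<le> ennreal (measure M (A \<inter> P))" using P assms by (intro ennreal_leI le) auto
  also have "\<dots> = emeasure M (A \<inter> P)" by (simp add: emeasure_eq_measure)
  also have "\<dots> \<le> emeasure M A" using assms by (intro emeasure_mono) auto
  finally show ?thesis .
qed

lemma nn_integral_pos_part_le:
  assumes "finite_measure M" "sets M = sets borel"
    and le: "\<And>B. B \<in> sets borel \<Longrightarrow> smeas \<nu> B \<le> measure M B"
  shows "nn_integral (pos_part \<nu>) f \<le> nn_integral M f"
proof (rule nn_integral_mono_measure)
  show "sets (pos_part \<nu>) = sets M" using assms by simp
  then show "pos_part \<nu> \<le> M"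
  proof (subst le_measure, assumption, intro ballI)
    fix A assume "A \<in> sets (pos_part \<nu>)"
    then show "emeasure (pos_part \<nu>) A \<le> emeasure M A"
      by (intro pos_part_least assms) simp
  qed
qed

lemma nn_integral_sum_measures:
  fixes M N :: "'i \<Rightarrow> real measure"
  assumes fin: "finite I" "finite J"
    and M: "\<And>i. i \<in> I \<Longrightarrow> finite_measure (M i)" "\<And>i. i \<in> I \<Longrightarrow> sets (M i) = sets borel"
    and N: "\<And>i. i \<in> J \<Longrightarrow> finite_measure (N i)" "\<And>i. i \<in> J \<Longrightarrow> sets (N i) = sets borel"
    and eq: "\<And>A. A \<in> sets borel \<Longrightarrow> (\<Sum>i\<in>I. measure (M i) A) = (\<Sum>i\<in>J. measure (N i) A)"
    and f: "f \<in> borel_measurable borel"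
  shows "(\<Sum>i\<in>I. \<integral>\<^sup>+x. f x \<partial>M i) = (\<Sum>i\<in>J. \<integral>\<^sup>+x. f x \<partial>N i)"
proof -
  have mM: "u \<in> borel_measurable (M i)" if "u \<in> borel_measurable borel" "i \<in> I" for u :: "real \<Rightarrow> ennreal" and i
    using that(1) measurable_cong_sets[OF M(2)[OF that(2)] refl[of "sets (borel :: ennreal measure)"]] by simp
  have mN: "u \<in> borel_measurable (N i)" if "u \<in> borel_measurable borel" "i \<in> J" for u :: "real \<Rightarrow> ennreal" and i
    using that(1) measurable_cong_sets[OF N(2)[OF that(2)] refl[of "sets (borel :: ennreal measure)"]] by simp
  from f show ?thesis
  proof (induction rule: borel_measurable_induct)
    case (cong f g)
    then have "f = g" by auto
    with cong show ?case by simp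
  next
    case (set A)
    have "(\<Sum>i\<in>I. emeasure (M i) A) = ennreal (\<Sum>i\<in>I. measure (M i) A)"
      using M(1) by (simp add: finite_measure.emeasure_eq_measure flip: sum_ennreal)
    also have "\<dots> = (\<Sum>i\<in>J. emeasure (N i) A)"
      unfolding eq[OF set] using N(1) by (simp add: finite_measure.emeasure_eq_measure flip: sum_ennreal)
    finally show ?case using set M(2) N(2) by simp
  next
    case (mult u c)
    have "(\<Sum>i\<in>I. \<integral>\<^sup>+x. c * u x \<partial>M i) = c * (\<Sum>i\<in>I. \<integral>\<^sup>+x. u x \<partial>M i)"
      unfolding sum_distrib_left by (intro sum.cong refl nn_integral_cmult mM mult)
    moreover have "(\<Sum>i\<in>J. \<integral>\<^sup>+x. c * u x \<partial>N i) = c * (\<Sum>i\<in>J. \<integral>\<^sup>+x. u x \<partial>N i)"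
      unfolding sum_distrib_left by (intro sum.cong refl nn_integral_cmult mN mult)
    ultimately show ?case using mult by simp
  next
    case (add u v)
    have "(\<Sum>i\<in>I. \<integral>\<^sup>+x. v x + u x \<partial>M i) = (\<Sum>i\<in>I. \<integral>\<^sup>+x. v x \<partial>M i) + (\<Sum>i\<in>I. \<integral>\<^sup>+x. u x \<partial>M i)"
      unfolding sum.distrib[symmetric] by (intro sum.cong refl nn_integral_add mM add)
    moreover have "(\<Sum>i\<in>J. \<integral>\<^sup>+x. v x + u x \<partial>N i) = (\<Sum>i\<in>J. \<integral>\<^sup>+x. v x \<partial>N i) + (\<Sum>i\<in>J. \<integral>\<^sup>+x. u x \<partial>N i)"
      unfolding sum.distrib[symmetric] by (intro sum.cong refl nn_integral_add mN add)
    ultimately show ?case using add by simp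
  next
    case (seq U)
    have "(\<Sum>i\<in>I. \<integral>\<^sup>+x. (SUP j. U j) x \<partial>M i) = (\<Sum>i\<in>I. SUP j. \<integral>\<^sup>+x. U j x \<partial>M i)"
      unfolding SUP_apply by (intro sum.cong refl nn_integral_monotone_convergence_SUP mM seq)
    also have "\<dots> = (SUP j. \<Sum>i\<in>I. \<integral>\<^sup>+x. U j x \<partial>M i)"
      using \<open>incseq U\<close> by (intro ennreal_SUP_sum[symmetric]) (auto simp: incseq_def le_fun_def intro!: nn_integral_mono)
    also have "\<dots> = (SUP j. \<Sum>i\<in>J. \<integral>\<^sup>+x. U j x \<partial>N i)" by (simp only: seq.IH)
    also have "\<dots> = (\<Sum>i\<in>J. SUP j. \<integral>\<^sup>+x. U j x \<partial>N i)"
      using \<open>incseq U\<close> by (intro ennreal_SUP_sum) (auto simp: incseq_def le_fun_def intro!: nn_integral_mono)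
    also have "\<dots> = (\<Sum>i\<in>J. \<integral>\<^sup>+x. (SUP j. U j) x \<partial>N i)"
      unfolding SUP_apply
      by (intro sum.cong refl nn_integral_monotone_convergence_SUP[symmetric] mN seq)
    finally show ?case .
  qed
qed

lemma integral_sum_measures:
  fixes M N :: "'i \<Rightarrow> real measure" and f :: "real \<Rightarrow> real"
  assumes fin: "finite I" "finite J"
    and M: "\<And>i. i \<in> I \<Longrightarrow> finite_measure (M i)" "\<And>i. i \<in> I \<Longrightarrow> sets (M i) = sets borel"
    and N: "\<And>i. i \<in> J \<Longrightarrow> finite_measure (N i)" "\<And>i. i \<in> J \<Longrightarrow> sets (N i) = sets borel"
    and eq: "\<And>A. A \<in> sets borel \<Longrightarrow> (\<Sum>i\<in>I. measure (M i) A) = (\<Sum>i\<in>J. measure (N i) A)"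
    and f: "f \<in> borel_measurable borel"
    and iM: "\<And>i. i \<in> I \<Longrightarrow> integrable (M i) f" and iN: "\<And>i. i \<in> J \<Longrightarrow> integrable (N i) f"
  shows "(\<Sum>i\<in>I. \<integral>x. f x \<partial>M i) = (\<Sum>i\<in>J. \<integral>x. f x \<partial>N i)"
proof -
  let ?R = "\<lambda>K L g. enn2real (\<Sum>i\<in>K. \<integral>\<^sup>+x. ennreal (g x) \<partial>L i)"
  have fp: "(\<lambda>x. ennreal (f x)) \<in> borel_measurable borel" "(\<lambda>x. ennreal (- f x)) \<in> borel_measurable borel"
    using f by measurable
  have fin_top: "(\<integral>\<^sup>+x. ennreal (f x) \<partial>L) < top \<and> (\<integral>\<^sup>+x. ennreal (- f x) \<partial>L) < top"
    if "integrable L f" for L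
    using that by (auto simp: real_integrable_def less_top)
  have split: "(\<Sum>i\<in>K. \<integral>x. f x \<partial>L i) = ?R K L f - ?R K L (\<lambda>x. - f x)"
    if "\<And>i. i \<in> K \<Longrightarrow> integrable (L i) f" for K and L :: "'i \<Rightarrow> real measure"
  proof -
    have "(\<Sum>i\<in>K. \<integral>x. f x \<partial>L i) =
        (\<Sum>i\<in>K. enn2real (\<integral>\<^sup>+x. ennreal (f x) \<partial>L i) - enn2real (\<integral>\<^sup>+x. ennreal (- f x) \<partial>L i))"
      by (intro sum.cong refl real_lebesgue_integral_def that)
    also have "\<dots> = ?R K L f - ?R K L (\<lambda>x. - f x)"
      using fin_top[OF that] by (simp add: sum_subtractf enn2real_sum)
    finally show ?thesis .
  qed
  have nn: "(\<Sum>i\<in>I. \<integral>\<^sup>+x. g x \<partial>M i) = (\<Sum>i\<in>J. \<integral>\<^sup>+x. g x \<partial>N i)"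
    if "g \<in> borel_measurable borel" for g :: "real \<Rightarrow> ennreal"
    using fin M N eq that by (rule nn_integral_sum_measures)
  have "(\<Sum>i\<in>I. \<integral>x. f x \<partial>M i) = ?R I M f - ?R I M (\<lambda>x. - f x)"
    using iM by (rule split)
  also have "\<dots> = ?R J N f - ?R J N (\<lambda>x. - f x)"
    by (simp only: nn[OF fp(1)] nn[OF fp(2)])
  also have "\<dots> = (\<Sum>i\<in>J. \<integral>x. f x \<partial>N i)"
    using iN by (rule split[symmetric])
  finally show ?thesis .
qed

definition smeas_of :: "real measure \<Rightarrow> smeasure" where
  "smeas_of M = Abs_smeasure (measure M)"

definition pmeas :: "real measure \<Rightarrow> bool" where
  "pmeas M \<longleftrightarrow> finite_measure M \<and> sets M = sets borel \<and> measure M {..<0} = 0"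

lemma pmeasD:
  assumes "pmeas M"
  shows "finite_measure M" "sets M = sets borel" "space M = UNIV" "measure M {..<0} = 0"
  using assms sets_eq_imp_space_eq[of M borel] by (auto simp: pmeas_def)

lemma smeas_smeas_of [simp]:
  assumes M: "pmeas M"
  shows "smeas (smeas_of M) A = measure M A"
proof -
  interpret finite_measure M using M by (simp add: pmeas_def)
  have "measure M A = 0" if "A \<in> sets borel" "A \<inter> {0..} = {}" for A
  proof -
    have "A \<subseteq> {..<0}" using that(2) by force
    then have "measure M A \<le> measure M {..<0}"
      using pmeasD[OF M] by (intro finite_measure_mono) auto
    then show ?thesis using pmeasD(4)[OF M] by (simp add: measure_le_0_iff)
  qed
  moreover have "(\<lambda>n. measure M (A n)) sums measure M (\<Union>n. A n)"
    if "range A \<subseteq> sets borel" "disjoint_family A" for A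
    using that pmeasD(2)[OF M] by (intro finite_measure_UNION) auto
  moreover have "measure M A = 0" if "A \<notin> sets borel" for A
    using that pmeasD(2)[OF M] by (simp add: measure_notin_sets)
  ultimately have "smeas (Abs_smeasure (measure M)) = measure M"
    by (intro Abs_smeasure_inverse) auto
  then show ?thesis by (simp add: smeas_of_def)
qed

lemma pmeas_pos_part [simp]: "pmeas (pos_part \<nu>)"
proof -
  obtain P where H: "Hahn_set \<nu> P" using Hahn_set_exists by blast
  have "emeasure (pos_part \<nu>) {..<0} = ennreal (smeas \<nu> ({..<0} \<inter> P))"
    by (rule emeasure_pos_part_Hahn[OF H]) simp
  also have "smeas \<nu> ({..<0} \<inter> P) = 0" by (rule smeas_outside) auto
  finally show ?thesis by (simp add: pmeas_def finite_pos_part measure_def)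
qed

lemma pmeas_neg_part [simp]: "pmeas (neg_part \<nu>)"
  by (simp add: neg_part_def)

lemma Jordan_smeas_of: "\<nu> = smeas_of (pos_part \<nu>) - smeas_of (neg_part \<nu>)"
  by (rule smeasure_eqI) (simp add: smeas_Jordan[symmetric])

lemma pos_part_smeas_of: "pmeas M \<Longrightarrow> pos_part (smeas_of M) = M"
  and neg_part_smeas_of: "pmeas M \<Longrightarrow> A \<in> sets borel \<Longrightarrow> emeasure (neg_part (smeas_of M)) A = 0"
proof -
  assume M: "pmeas M"
  show neg: "emeasure (neg_part (smeas_of M)) A = 0" if A: "A \<in> sets borel" for A
  proof -
    have "emeasure (pos_part (- smeas_of M)) A \<le> emeasure (null_measure (borel :: real measure)) A"
      using A M by (intro pos_part_least) (auto intro!: finite_measureI)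
    then show ?thesis by (simp add: neg_part_def)
  qed
  show "pos_part (smeas_of M) = M"
  proof (rule measure_eqI)
    show "sets (pos_part (smeas_of M)) = sets M" using pmeasD[OF M] by simp
    fix A assume "A \<in> sets (pos_part (smeas_of M))"
    then have A: "A \<in> sets borel" by simp
    interpret p: finite_measure "pos_part (smeas_of M)" by (rule finite_pos_part)
    interpret m: finite_measure M by (rule pmeasD[OF M])
    have "measure M A = measure (pos_part (smeas_of M)) A"
      using smeas_Jordan[of "smeas_of M" A] neg[OF A] M by (simp add: measure_def)
    then show "emeasure (pos_part (smeas_of M)) A = emeasure M A"
      by (simp add: p.emeasure_eq_measure m.emeasure_eq_measure)
  qed
qed

definition sintegrable :: "smeasure \<Rightarrow> (real \<Rightarrow> real) \<Rightarrow> bool" where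
  "sintegrable \<nu> f \<longleftrightarrow> integrable (pos_part \<nu>) f \<and> integrable (neg_part \<nu>) f"

lemma sintegrable_measurable: "sintegrable \<nu> f \<Longrightarrow> f \<in> borel_measurable borel"
  using borel_measurable_integrable[of "pos_part \<nu>" f] measurable_cong_sets[OF sets_pos_part[of \<nu>] refl[of "sets (borel :: real measure)"]]
  by (simp add: sintegrable_def)

lemma
  assumes M: "pmeas M" and f: "integrable M f"
  shows sintegrable_smeas_of: "sintegrable (smeas_of M) f"
    and sintegral_smeas_of: "sintegral (smeas_of M) f = (\<integral>x. f x \<partial>M)"
proof -
  let ?n = "neg_part (smeas_of M)"
  have AE: "AE x in ?n. f x = 0"
    by (rule AE_I[of _ _ UNIV]) (auto simp: neg_part_smeas_of[OF M])
  have m: "f \<in> borel_measurable ?n"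
    using borel_measurable_integrable[OF f] measurable_cong_sets[OF pmeasD(2)[OF M] refl[of "sets (borel :: real measure)"]]
      measurable_cong_sets[OF sets_neg_part[of "smeas_of M"] refl[of "sets (borel :: real measure)"]] by simp
  have "integrable ?n f"
    using integrable_cong_AE[OF m _ AE] by simp
  then show "sintegrable (smeas_of M) f"
    using f by (simp add: sintegrable_def pos_part_smeas_of[OF M])
  have "(\<integral>x. f x \<partial>?n) = 0" using integral_cong_AE[OF m _ AE] by simp
  then show "sintegral (smeas_of M) f = (\<integral>x. f x \<partial>M)"
    by (simp add: sintegral_def pos_part_smeas_of[OF M])
qed

lemma uminus_uminus_parts: "pos_part (- \<nu>) = neg_part \<nu>" "neg_part (- \<nu>) = pos_part \<nu>"
  by (simp_all add: neg_part_def)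

lemma sintegrable_uminus: "sintegrable (- \<nu>) f \<longleftrightarrow> sintegrable \<nu> f"
  by (auto simp: sintegrable_def uminus_uminus_parts)

lemma sintegral_uminus: "sintegral (- \<nu>) f = - sintegral \<nu> f"
  by (simp add: sintegral_def uminus_uminus_parts)

lemma nn_integral_pos_part_add_le:
  assumes f: "f \<in> borel_measurable borel"
  shows "(\<integral>\<^sup>+x. f x \<partial>pos_part (\<mu> + \<nu>)) \<le> (\<integral>\<^sup>+x. f x \<partial>pos_part \<mu>) + (\<integral>\<^sup>+x. f x \<partial>pos_part \<nu>)"
proof -
  define T where "T = pos_part (smeas_of (pos_part \<mu>) + smeas_of (pos_part \<nu>))"
  have T: "measure T A = measure (pos_part \<mu>) A + measure (pos_part \<nu>) A" if A: "A \<in> sets borel" for A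
  proof -
    let ?s = "smeas_of (pos_part \<mu>) + smeas_of (pos_part \<nu>)"
    have "emeasure (pos_part (- ?s)) A \<le> emeasure (null_measure (borel :: real measure)) A"
      using A by (intro pos_part_least)
        (auto intro!: finite_measureI simp: minus_le_iff intro: order_trans[OF _ measure_nonneg])
    then have "measure (neg_part ?s) A = 0" by (simp add: neg_part_def measure_def)
    then show ?thesis using smeas_Jordan[of ?s A] by (simp add: T_def)
  qed
  have Tb: "finite_measure T" "sets T = sets borel" by (simp_all add: T_def finite_pos_part)
  have "smeas (\<mu> + \<nu>) A \<le> measure T A" if "A \<in> sets borel" for A
    using T[OF that] smeas_Jordan[of \<mu> A] smeas_Jordan[of \<nu> A] measure_nonneg[of "neg_part \<mu>" A] measure_nonneg[of "neg_part \<nu>" A]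
    unfolding smeas_add by linarith
  then have "(\<integral>\<^sup>+x. f x \<partial>pos_part (\<mu> + \<nu>)) \<le> (\<integral>\<^sup>+x. f x \<partial>T)"
    by (intro nn_integral_pos_part_le Tb)
  also have "\<dots> = (\<integral>\<^sup>+x. f x \<partial>pos_part \<mu>) + (\<integral>\<^sup>+x. f x \<partial>pos_part \<nu>)"
    using nn_integral_sum_measures[of "{False}" UNIV "\<lambda>_. T" "\<lambda>b. if b then pos_part \<mu> else pos_part \<nu>" f]
      Tb T f by (simp add: finite_pos_part UNIV_bool add.commute)
  finally show ?thesis .
qed

lemma sintegrable_add:
  assumes "sintegrable \<mu> f" "sintegrable \<nu> f"
  shows "sintegrable (\<mu> + \<nu>) f"
proof -
  have f: "f \<in> borel_measurable borel" by (rule sintegrable_measurable) fact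
  have pos: "integrable (pos_part (\<mu> + \<nu>)) f"
    if "integrable (pos_part \<mu>) f" "integrable (pos_part \<nu>) f" for \<mu> \<nu>
  proof (rule integrableI_bounded)
    show "f \<in> borel_measurable (pos_part (\<mu> + \<nu>))"
      using f measurable_cong_sets[OF sets_pos_part[of "\<mu> + \<nu>"] refl[of "sets (borel :: real measure)"]] by simp
    have "(\<integral>\<^sup>+x. ennreal (norm (f x)) \<partial>pos_part (\<mu> + \<nu>)) \<le>
       (\<integral>\<^sup>+x. ennreal (norm (f x)) \<partial>pos_part \<mu>) + (\<integral>\<^sup>+x. ennreal (norm (f x)) \<partial>pos_part \<nu>)"
      using f by (intro nn_integral_pos_part_add_le) measurable
    also have "\<dots> < \<infinity>" using that by (simp add: integrable_iff_bounded)
    finally show "(\<integral>\<^sup>+x. ennreal (norm (f x)) \<partial>pos_part (\<mu> + \<nu>)) < \<infinity>" .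
  qed
  from pos[of \<mu> \<nu>] pos[of "- \<mu>" "- \<nu>"] assms show ?thesis
    by (simp add: sintegrable_def uminus_uminus_parts) (simp add: neg_part_def)
qed

lemma sintegral_add:
  assumes "sintegrable \<mu> f" "sintegrable \<nu> f"
  shows "sintegral (\<mu> + \<nu>) f = sintegral \<mu> f + sintegral \<nu> f"
proof -
  have f: "f \<in> borel_measurable borel" by (rule sintegrable_measurable) fact
  note add = sintegrable_add[OF assms]
  define M where "M i = (if i = (0::nat) then pos_part (\<mu> + \<nu>) else if i = 1 then neg_part \<mu> else neg_part \<nu>)" for i
  define N where "N i = (if i = (0::nat) then neg_part (\<mu> + \<nu>) else if i = 1 then pos_part \<mu> else pos_part \<nu>)" for i
  have "(\<Sum>i\<in>{0,1,2}. \<integral>x. f x \<partial>M i) = (\<Sum>i\<in>{0,1,2}. \<integral>x. f x \<partial>N i)"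
  proof (rule integral_sum_measures)
    fix A
    show "(\<Sum>i\<in>{0,1,2}. measure (M i) A) = (\<Sum>i\<in>{0,1,2}. measure (N i) A)"
      using smeas_Jordan[of "\<mu> + \<nu>" A] smeas_Jordan[of \<mu> A] smeas_Jordan[of \<nu> A]
      by (simp add: M_def N_def)
  qed (use f add assms in \<open>auto simp: M_def N_def finite_pos_part finite_neg_part sintegrable_def\<close>)
  then show ?thesis by (simp add: M_def N_def sintegral_def)
qed

lemma sintegrable_bounded:
  assumes "f \<in> borel_measurable borel" "\<And>x. \<bar>f x\<bar> \<le> B"
  shows "sintegrable \<nu> f"
proof -
  interpret p: finite_measure "pos_part \<nu>" by (rule finite_pos_part)
  interpret n: finite_measure "neg_part \<nu>" by (rule finite_neg_part)
  show ?thesis unfolding sintegrable_def using assms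
      measurable_cong_sets[OF sets_pos_part[of \<nu>] refl[of "sets (borel :: real measure)"]]
      measurable_cong_sets[OF sets_neg_part[of \<nu>] refl[of "sets (borel :: real measure)"]]
    by (auto intro!: p.integrable_const_bound[of _ B] n.integrable_const_bound[of _ B])
qed

lemma sintegral_indicator: "A \<in> sets borel \<Longrightarrow> sintegral \<nu> (indicator A) = smeas \<nu> A"
  by (simp add: sintegral_def smeas_Jordan)

lemma measurable_pos_part: "f \<in> borel_measurable (pos_part \<nu>) \<longleftrightarrow> f \<in> borel_measurable borel"
  for f :: "real \<Rightarrow> real"
  using measurable_cong_sets[OF sets_pos_part[of \<nu>] refl[of "sets (borel :: real measure)"]] by simp

lemma measurable_neg_part: "f \<in> borel_measurable (neg_part \<nu>) \<longleftrightarrow> f \<in> borel_measurable borel"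
  for f :: "real \<Rightarrow> real"
  by (simp add: neg_part_def measurable_pos_part)

lemma integrable_indicator_pmeas:
  fixes f :: "real \<Rightarrow> real"
  assumes M: "pmeas M" and f: "integrable M f"
  shows "A \<in> sets borel \<Longrightarrow> integrable M (\<lambda>x. f x * indicator A x)"
    and "A \<in> sets borel \<Longrightarrow> A \<inter> {0..} = {} \<Longrightarrow> (\<integral>x. f x * indicator A x \<partial>M) = 0"
    and "range B \<subseteq> sets borel \<Longrightarrow> disjoint_family B \<Longrightarrow>
      (\<lambda>n::nat. \<integral>x. f x * indicator (B n) x \<partial>M) sums (\<integral>x. f x * indicator (\<Union>n. B n) x \<partial>M)"
proof -
  have i: "integrable M (\<lambda>x. f x * indicator A x)" if "A \<in> sets borel" for A
    using that f pmeasD(2)[OF M] by (intro integrable_real_mult_indicator) auto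
  then show "A \<in> sets borel \<Longrightarrow> integrable M (\<lambda>x. f x * indicator A x)" .
  have [measurable]: "f \<in> borel_measurable M" using f by auto
  show "(\<integral>x. f x * indicator A x \<partial>M) = 0" if A: "A \<in> sets borel" "A \<inter> {0..} = {}"
  proof -
    have "emeasure M {..<0} = 0"
      using pmeasD[OF M] by (simp add: finite_measure.emeasure_eq_measure)
    then have "AE x in M. x \<notin> {..<0}"
      using pmeasD(2)[OF M] by (intro AE_not_in) auto
    then have "AE x in M. f x * indicator A x = 0"
      by eventually_elim (use A(2) in \<open>auto simp: indicator_def disjoint_iff\<close>)
    then show ?thesis by (rule integral_eq_zero_AE)
  qed
  show "(\<lambda>n. \<integral>x. f x * indicator (B n) x \<partial>M) sums (\<integral>x. f x * indicator (\<Union>n. B n) x \<partial>M)"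
    if B: "range B \<subseteq> sets borel" "disjoint_family B"
  proof -
    have Bs: "B n \<in> sets borel" for n using B(1) by auto
    have s: "(\<lambda>n. indicator (B n) x :: real) sums indicator (\<Union>n. B n) x" for x
      using B(2) by (intro indicator_sums) (auto simp: disjoint_family_on_def)
    have eq: "(\<integral>x. (\<Sum>i<n. f x * indicator (B i) x) \<partial>M) = (\<Sum>i<n. \<integral>x. f x * indicator (B i) x \<partial>M)" for n
      using i Bs by (intro Bochner_Integration.integral_sum) auto
    have "(\<lambda>n. \<integral>x. (\<Sum>i<n. f x * indicator (B i) x) \<partial>M) \<longlonglongrightarrow> (\<integral>x. f x * indicator (\<Union>n. B n) x \<partial>M)"
    proof (rule integral_dominated_convergence[where w = "\<lambda>x. \<bar>f x\<bar>"])
      show "(\<lambda>x. f x * indicator (\<Union>n. B n) x) \<in> borel_measurable M"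
        using Bs by (intro borel_measurable_integrable i) auto
      show "(\<lambda>x. \<Sum>i<n. f x * indicator (B i) x) \<in> borel_measurable M" for n
        using Bs by (intro borel_measurable_sum borel_measurable_integrable i) auto
      show "integrable M (\<lambda>x. \<bar>f x\<bar>)" using f by simp
      show "AE x in M. (\<lambda>n. \<Sum>i<n. f x * indicator (B i) x) \<longlonglongrightarrow> f x * indicator (\<Union>n. B n) x"
        using s by (intro AE_I2) (simp add: sums_def flip: sum_distrib_left, intro tendsto_intros, simp)
      have "\<bar>\<Sum>i<n. f x * indicator (B i) x\<bar> \<le> \<bar>f x\<bar>" for n x
      proof -
        have "(\<Sum>i<n. indicator (B i) x :: real) \<le> indicator (\<Union>n. B n) x"
          using s[of x] sum_le_suminf[of "\<lambda>n. indicator (B n) x :: real" "{..<n}"] by (simp add: sums_iff)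
        also have "\<dots> \<le> 1" by (simp add: indicator_def)
        finally have "\<bar>\<Sum>i<n. indicator (B i) x :: real\<bar> \<le> 1" by (simp add: sum_nonneg)
        then show ?thesis
          by (simp add: abs_mult mult_left_le flip: sum_distrib_left)
      qed
      then show "AE x in M. norm (\<Sum>i<n. f x * indicator (B i) x) \<le> \<bar>f x\<bar>" for n by simp
    qed
    then show ?thesis unfolding sums_def eq .
  qed
qed

lemma smeas_sdensity:
  assumes f: "sintegrable \<nu> f" and A: "A \<in> sets borel"
  shows "smeas (sdensity f \<nu>) A = sintegral \<nu> (\<lambda>x. f x * indicator A x)"
proof -
  let ?d = "\<lambda>A. if A \<in> sets borel then sintegral \<nu> (\<lambda>x. f x * indicator A x) else 0"
  have p: "integrable (pos_part \<nu>) f" and n: "integrable (neg_part \<nu>) f"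
    using f by (simp_all add: sintegrable_def)
  note P = integrable_indicator_pmeas[OF pmeas_pos_part p] and N = integrable_indicator_pmeas[OF pmeas_neg_part n]
  have "smeas (Abs_smeasure ?d) = ?d"
  proof (rule Abs_smeasure_inverse, intro CollectI conjI allI impI ballI)
    fix B :: "nat \<Rightarrow> real set" assume B: "range B \<subseteq> sets borel" "disjoint_family B"
    then have "B n \<in> sets borel" for n by auto
    then show "(\<lambda>n. ?d (B n)) sums ?d (\<Union>n. B n)"
      using sums_diff[OF P(3)[OF B] N(3)[OF B]] by (simp add: sintegral_def sets.countable_UN)
  next
    fix B :: "real set" assume "B \<in> sets borel" "B \<inter> {0..} = {}"
    then show "?d B = 0" using P(2) N(2) by (simp add: sintegral_def)
  qed simp
  with A show ?thesis by (simp add: sdensity_def)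
qed

lemma prod_dist_aux:
  fixes \<phi> :: "real \<Rightarrow> real"
  assumes a: "pmeas a" and b: "pmeas b"
  defines "D \<equiv> distr (a \<Otimes>\<^sub>M b) borel (\<lambda>(x, y). x * y)"
  shows "pmeas D"
    and "integrable (a \<Otimes>\<^sub>M b) (\<lambda>(x, y). \<phi> (x * y)) \<Longrightarrow> \<phi> \<in> borel_measurable borel \<Longrightarrow>
      integrable D \<phi> \<and> integrable b (\<lambda>y. \<integral>x. \<phi> (x * y) \<partial>a) \<and>
      (\<integral>y. (\<integral>x. \<phi> (x * y) \<partial>a) \<partial>b) = (\<integral>x. \<phi> x \<partial>D)"
proof -
  interpret a: finite_measure a by (rule pmeasD[OF a])
  interpret b: finite_measure b by (rule pmeasD[OF b])
  interpret ab: pair_sigma_finite a b ..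
  interpret fab: finite_measure "a \<Otimes>\<^sub>M b" by (rule finite_measure_pair_measure) unfold_locales
  note [measurable_cong] = pmeasD(2)[OF a] pmeasD(2)[OF b]
  have T[measurable]: "(\<lambda>(x, y). x * y) \<in> borel_measurable (a \<Otimes>\<^sub>M b)" by measurable
  have "finite_measure D" unfolding D_def by (rule fab.finite_measure_distr) (rule T)
  moreover have "emeasure D {..<0} = 0"
  proof -
    have "emeasure D {..<0} = emeasure (a \<Otimes>\<^sub>M b) ((\<lambda>(x, y). x * y) -` {..<0} \<inter> space (a \<Otimes>\<^sub>M b))"
      unfolding D_def by (rule emeasure_distr[OF T]) simp
    also have "\<dots> \<le> emeasure (a \<Otimes>\<^sub>M b) (({..<0} \<times> UNIV) \<union> (UNIV \<times> {..<0}))"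
      using pmeasD(2)[OF a] pmeasD(2)[OF b]
      by (intro emeasure_mono) (auto simp: mult_less_0_iff)
    also have "\<dots> \<le> emeasure (a \<Otimes>\<^sub>M b) ({..<0} \<times> UNIV) + emeasure (a \<Otimes>\<^sub>M b) (UNIV \<times> {..<0})"
      using pmeasD(2)[OF a] pmeasD(2)[OF b] by (intro emeasure_subadditive) auto
    also have "\<dots> = 0"
      using pmeasD[OF a] pmeasD[OF b]
      by (simp add: b.emeasure_pair_measure_Times a.emeasure_eq_measure b.emeasure_eq_measure)
    finally show ?thesis by simp
  qed
  ultimately show "pmeas D" by (simp add: pmeas_def D_def measure_def)
  assume i: "integrable (a \<Otimes>\<^sub>M b) (\<lambda>(x, y). \<phi> (x * y))" and m: "\<phi> \<in> borel_measurable borel"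
  have "integrable D \<phi>"
    unfolding D_def using i by (subst integrable_distr_eq[OF T m]) (simp add: case_prod_unfold)
  moreover have "(\<integral>x. \<phi> x \<partial>D) = integral\<^sup>L (a \<Otimes>\<^sub>M b) (\<lambda>(x, y). \<phi> (x * y))"
    unfolding D_def by (subst integral_distr[OF T m]) (simp add: case_prod_unfold)
  ultimately show "integrable D \<phi> \<and> integrable b (\<lambda>y. \<integral>x. \<phi> (x * y) \<partial>a) \<and>
      (\<integral>y. (\<integral>x. \<phi> (x * y) \<partial>a) \<partial>b) = (\<integral>x. \<phi> x \<partial>D)"
    using ab.integrable_snd[OF i] ab.integral_snd[OF i] by simp
qed

definition mellin_distr :: "real measure \<Rightarrow> real measure \<Rightarrow> real measure" where
  "mellin_distr a b = distr (a \<Otimes>\<^sub>M b) borel (\<lambda>(x, y). x * y)"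

definition mellin_sum :: "smeasure \<Rightarrow> smeasure \<Rightarrow> smeasure" where
  "mellin_sum \<mu> \<nu> =
     (smeas_of (mellin_distr (pos_part \<mu>) (pos_part \<nu>)) + smeas_of (mellin_distr (neg_part \<mu>) (neg_part \<nu>)))
     + - (smeas_of (mellin_distr (neg_part \<mu>) (pos_part \<nu>)) + smeas_of (mellin_distr (pos_part \<mu>) (neg_part \<nu>)))"

lemma sintegral_mellin_sum:
  assumes m: "\<phi> \<in> borel_measurable borel"
    and i: "\<And>a b. a \<in> {pos_part \<mu>, neg_part \<mu>} \<Longrightarrow> b \<in> {pos_part \<nu>, neg_part \<nu>} \<Longrightarrow>
      integrable (a \<Otimes>\<^sub>M b) (\<lambda>(x, y). \<phi> (x * y))"
  shows "sintegral \<nu> (\<lambda>y. sintegral \<mu> (\<lambda>x. \<phi> (x * y))) = sintegral (mellin_sum \<mu> \<nu>) \<phi>"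
proof -
  let ?p = "pos_part \<mu>" and ?n = "neg_part \<mu>" and ?p' = "pos_part \<nu>" and ?n' = "neg_part \<nu>"
  have f: "pmeas (mellin_distr a b)" "integrable (mellin_distr a b) \<phi>"
      "integrable b (\<lambda>y. \<integral>x. \<phi> (x * y) \<partial>a)"
      "(\<integral>y. (\<integral>x. \<phi> (x * y) \<partial>a) \<partial>b) = (\<integral>x. \<phi> x \<partial>mellin_distr a b)"
    if "a \<in> {?p, ?n}" "b \<in> {?p', ?n'}" for a b
  proof -
    have "pmeas a" "pmeas b" using that by auto
    note ab = this
    show "pmeas (mellin_distr a b)" "integrable (mellin_distr a b) \<phi>"
      "integrable b (\<lambda>y. \<integral>x. \<phi> (x * y) \<partial>a)"
      "(\<integral>y. (\<integral>x. \<phi> (x * y) \<partial>a) \<partial>b) = (\<integral>x. \<phi> x \<partial>mellin_distr a b)"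
      using prod_dist_aux(1)[OF ab] prod_dist_aux(2)[OF ab i[OF that] m] unfolding mellin_distr_def by blast+
  qed
  have s: "sintegrable (smeas_of (mellin_distr a b)) \<phi>"
      "sintegral (smeas_of (mellin_distr a b)) \<phi> = (\<integral>y. (\<integral>x. \<phi> (x * y) \<partial>a) \<partial>b)"
    if "a \<in> {?p, ?n}" "b \<in> {?p', ?n'}" for a b
    using sintegrable_smeas_of sintegral_smeas_of f[OF that] by simp_all
  have "sintegral (mellin_sum \<mu> \<nu>) \<phi> =
     (\<integral>y. (\<integral>x. \<phi> (x * y) \<partial>?p) \<partial>?p') + (\<integral>y. (\<integral>x. \<phi> (x * y) \<partial>?n) \<partial>?n')
     - ((\<integral>y. (\<integral>x. \<phi> (x * y) \<partial>?n) \<partial>?p') + (\<integral>y. (\<integral>x. \<phi> (x * y) \<partial>?p) \<partial>?n'))"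
    unfolding mellin_sum_def
    by (simp add: sintegral_add sintegrable_add sintegrable_uminus sintegral_uminus s
        del: minus_add_distrib add_uminus_conv_diff)
  moreover have "sintegral \<nu> (\<lambda>y. sintegral \<mu> (\<lambda>x. \<phi> (x * y))) =
     ((\<integral>y. (\<integral>x. \<phi> (x * y) \<partial>?p) \<partial>?p') - (\<integral>y. (\<integral>x. \<phi> (x * y) \<partial>?n) \<partial>?p'))
     - ((\<integral>y. (\<integral>x. \<phi> (x * y) \<partial>?p) \<partial>?n') - (\<integral>y. (\<integral>x. \<phi> (x * y) \<partial>?n) \<partial>?n'))"
    unfolding sintegral_def using f(3) by simp
  ultimately show ?thesis by simp
qed

lemma integrable_mellin_bounded:
  assumes a: "pmeas a" and b: "pmeas b" and m: "\<phi> \<in> borel_measurable borel"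
    and S: "S \<in> sets borel" "T \<in> sets borel" "measure a (- S) = 0" "measure b (- T) = 0"
    and B: "\<And>x y :: real. x \<in> S \<Longrightarrow> y \<in> T \<Longrightarrow> \<bar>\<phi> (x * y)\<bar> \<le> (B :: real)"
  shows "integrable (a \<Otimes>\<^sub>M b) (\<lambda>(x, y). \<phi> (x * y))"
proof -
  interpret a: finite_measure a by (rule pmeasD[OF a])
  interpret b: finite_measure b by (rule pmeasD[OF b])
  interpret fab: finite_measure "a \<Otimes>\<^sub>M b" by (rule finite_measure_pair_measure) unfold_locales
  note [measurable_cong] = pmeasD(2)[OF a] pmeasD(2)[OF b]
  note [measurable] = m
  show ?thesis
  proof (rule fab.integrable_const_bound[where B = B])
    show "(\<lambda>(x, y). \<phi> (x * y)) \<in> borel_measurable (a \<Otimes>\<^sub>M b)" by measurable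
    show "AE z in a \<Otimes>\<^sub>M b. norm (case z of (x, y) \<Rightarrow> \<phi> (x * y)) \<le> B"
    proof (rule AE_I)
      let ?N = "((- S) \<times> UNIV) \<union> (UNIV \<times> (- T))"
      show "{z \<in> space (a \<Otimes>\<^sub>M b). \<not> norm (case z of (x, y) \<Rightarrow> \<phi> (x * y)) \<le> B} \<subseteq> ?N"
        using B by auto
      show "?N \<in> sets (a \<Otimes>\<^sub>M b)" using S pmeasD(2)[OF a] pmeasD(2)[OF b] by auto
      have "emeasure (a \<Otimes>\<^sub>M b) ?N \<le> emeasure (a \<Otimes>\<^sub>M b) ((- S) \<times> UNIV) + emeasure (a \<Otimes>\<^sub>M b) (UNIV \<times> (- T))"
        using S pmeasD(2)[OF a] pmeasD(2)[OF b] by (intro emeasure_subadditive) auto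
      also have "\<dots> = 0"
        using S pmeasD[OF a] pmeasD[OF b]
        by (simp add: b.emeasure_pair_measure_Times a.emeasure_eq_measure b.emeasure_eq_measure)
      finally show "emeasure (a \<Otimes>\<^sub>M b) ?N = 0" by simp
    qed
  qed
qed

lemma mellin_conv_eq_mellin_sum: "mellin_conv \<mu> \<nu> = mellin_sum \<mu> \<nu>"
proof -
  have "(\<lambda>A. if A \<in> sets borel then sintegral \<nu> (\<lambda>y. sintegral \<mu> (\<lambda>x. indicator A (x * y))) else 0)
     = smeas (mellin_sum \<mu> \<nu>)"
  proof
    fix A
    show "(if A \<in> sets borel then sintegral \<nu> (\<lambda>y. sintegral \<mu> (\<lambda>x. indicator A (x * y))) else 0)
     = smeas (mellin_sum \<mu> \<nu>) A"
    proof (cases "A \<in> sets borel")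
      case True
      have "sintegral \<nu> (\<lambda>y. sintegral \<mu> (\<lambda>x. indicator A (x * y))) = sintegral (mellin_sum \<mu> \<nu>) (indicator A)"
        using True by (intro sintegral_mellin_sum integrable_mellin_bounded[of _ _ _ UNIV UNIV 1]) auto
      with True show ?thesis by (simp add: sintegral_indicator)
    qed (simp add: smeas_not_borel)
  qed
  then show ?thesis by (simp add: mellin_conv_def smeas_inverse)
qed

lemma smeas_mellin_conv:
  "A \<in> sets borel \<Longrightarrow>
    smeas (mellin_conv \<mu> \<nu>) A = sintegral \<nu> (\<lambda>y. sintegral \<mu> (\<lambda>x. indicator A (x * y)))"
  unfolding mellin_conv_eq_mellin_sum sintegral_indicator[symmetric]
  by (intro sintegral_mellin_sum[symmetric] integrable_mellin_bounded[of _ _ _ UNIV UNIV 1]) auto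

text \<open>Complement of the union of all open sets on which \<open>\<nu>\<close> vanishes.\<close>

definition ssupport :: "smeasure \<Rightarrow> real set" where
  "ssupport \<nu> = {x. \<forall>U. open U \<longrightarrow> x \<in> U \<longrightarrow> (\<exists>A\<in>sets borel. A \<subseteq> U \<and> smeas \<nu> A \<noteq> 0)}"

lemma ssupport_subset_iff:
  assumes S: "closed S"
  shows "ssupport \<nu> \<subseteq> S \<longleftrightarrow> (\<forall>A\<in>sets borel. A \<inter> S = {} \<longrightarrow> smeas \<nu> A = 0)"
proof
  assume r: "\<forall>A\<in>sets borel. A \<inter> S = {} \<longrightarrow> smeas \<nu> A = 0"
  show "ssupport \<nu> \<subseteq> S"
  proof
    fix x assume "x \<in> ssupport \<nu>"
    show "x \<in> S"
    proof (rule ccontr)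
      assume "x \<notin> S"
      moreover have "open (- S)" using S by (simp add: open_Compl)
      ultimately obtain A where "A \<in> sets borel" "A \<subseteq> - S" "smeas \<nu> A \<noteq> 0"
        using \<open>x \<in> ssupport \<nu>\<close> unfolding ssupport_def by blast
      with r show False by blast
    qed
  qed
next
  assume l: "ssupport \<nu> \<subseteq> S"
  show "\<forall>A\<in>sets borel. A \<inter> S = {} \<longrightarrow> smeas \<nu> A = 0"
  proof (intro ballI impI)
    fix A :: "real set" assume A: "A \<in> sets borel" "A \<inter> S = {}"
    define F where "F = {U. open U \<and> (\<forall>A\<in>sets borel. A \<subseteq> U \<longrightarrow> smeas \<nu> A = 0)}"
    have "A \<subseteq> \<Union>F"
    proof
      fix x assume "x \<in> A"
      with A(2) l have "x \<notin> ssupport \<nu>" by blast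
      then show "x \<in> \<Union>F" unfolding ssupport_def F_def by blast
    qed
    moreover obtain F' where F': "F' \<subseteq> F" "countable F'" "\<Union>F' = \<Union>F"
      using Lindelof[of F] unfolding F_def by blast
    ultimately have cov: "A \<subseteq> \<Union>F'" by simp
    define G where "G = from_nat_into (insert {} F')"
    have rG: "range G = insert {} F'" unfolding G_def using F'(2) by (intro range_from_nat_into) auto
    have nG: "\<forall>B\<in>sets borel. B \<subseteq> G n \<longrightarrow> smeas \<nu> B = 0" and oG: "open (G n)" for n
    proof -
      have "G n \<in> insert {} F'" using rG by blast
      then show "\<forall>B\<in>sets borel. B \<subseteq> G n \<longrightarrow> smeas \<nu> B = 0" "open (G n)"
        using F'(1) by (auto simp: F_def)
    qed
    have d: "disjointed G n \<in> sets borel" for n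
      using sets.range_disjointed_sets[of G borel] borel_open[OF oG] by (auto simp: image_subset_iff)
    have dis: "disjoint_family (\<lambda>n. A \<inter> disjointed G n)"
      using disjoint_family_disjointed[of G] unfolding disjoint_family_on_def by blast
    have "(\<lambda>n. smeas \<nu> (A \<inter> disjointed G n)) sums smeas \<nu> (\<Union>n. A \<inter> disjointed G n)"
      using A d dis by (intro smeas_sums) auto
    moreover have "(\<Union>n. A \<inter> disjointed G n) = A"
    proof -
      have "\<Union>(range G) = \<Union>F'" using rG by simp
      then show ?thesis using cov UN_disjointed_eq[of G] by auto
    qed
    moreover have "smeas \<nu> (A \<inter> disjointed G n) = 0" for n
      using nG[of n] A(1) d[of n] disjointed_subset[of G n]
      by (meson inf.coboundedI2 sets.Int)
    ultimately show "smeas \<nu> A = 0" by (simp add: sums_unique2[OF _ sums_zero])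
  qed
qed

lemma parts_null_outside_support:
  assumes "closed S" "ssupport \<nu> \<subseteq> S"
  shows "measure (pos_part \<nu>) (- S) = 0" "measure (neg_part \<nu>) (- S) = 0"
proof -
  have S: "- S \<in> sets borel" using assms(1) by auto
  have *: "emeasure (pos_part \<rho>) (- S) = 0" if "\<forall>A\<in>sets borel. A \<inter> S = {} \<longrightarrow> smeas \<rho> A = 0" for \<rho>
  proof -
    obtain P where H: "Hahn_set \<rho> P" using Hahn_set_exists by blast
    have "smeas \<rho> (- S \<inter> P) = 0" using that S Hahn_setD(1)[OF H] by auto
    then show ?thesis using emeasure_pos_part_Hahn[OF H S] by simp
  qed
  have "\<forall>A\<in>sets borel. A \<inter> S = {} \<longrightarrow> smeas \<nu> A = 0" using ssupport_subset_iff assms by blast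
  then show "measure (pos_part \<nu>) (- S) = 0" "measure (neg_part \<nu>) (- S) = 0"
    using *[of \<nu>] *[of "- \<nu>"] by (simp_all add: measure_def neg_part_def)
qed

theorem sintegral_mellin_conv:
  assumes \<mu>: "ssupport \<mu> \<subseteq> {0..a}" and \<nu>: "ssupport \<nu> \<subseteq> {0..b}" and \<phi>: "continuous_on UNIV (\<phi> :: real \<Rightarrow> real)"
  shows "sintegral (mellin_conv \<mu> \<nu>) \<phi> = sintegral \<nu> (\<lambda>y. sintegral \<mu> (\<lambda>x. \<phi> (x * y)))"
proof -
  have "compact (\<phi> ` {0..a * b})"
    using \<phi> by (intro compact_continuous_image) (auto intro: continuous_on_subset)
  then have "bounded (\<phi> ` {0..a * b})" by (rule compact_imp_bounded)
  then obtain B where "\<forall>x\<in>\<phi> ` {0..a * b}. norm x \<le> B"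
    by (auto simp only: bounded_iff)
  then have B: "\<bar>\<phi> z\<bar> \<le> B" if "z \<in> {0..a * b}" for z using that by simp
  have prod: "x * y \<in> {0..a * b}" if "x \<in> {0..a}" "y \<in> {0..b}" for x y
    using that by (auto intro: mult_mono)
  have m: "\<phi> \<in> borel_measurable borel" by (rule borel_measurable_continuous_onI) (rule \<phi>)
  have "sintegral \<nu> (\<lambda>y. sintegral \<mu> (\<lambda>x. \<phi> (x * y))) = sintegral (mellin_sum \<mu> \<nu>) \<phi>"
  proof (rule sintegral_mellin_sum[OF m])
    fix p q assume p: "p \<in> {pos_part \<mu>, neg_part \<mu>}" and q: "q \<in> {pos_part \<nu>, neg_part \<nu>}"
    show "integrable (p \<Otimes>\<^sub>M q) (\<lambda>(x, y). \<phi> (x * y))"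
    proof (rule integrable_mellin_bounded[of p q \<phi> "{0..a}" "{0..b}" B])
      show "measure p (- {0..a}) = 0" "measure q (- {0..b}) = 0"
        using p q parts_null_outside_support[OF _ \<mu>] parts_null_outside_support[OF _ \<nu>] by auto
    qed (use p q m B prod in auto)
  qed
  then show ?thesis by (simp add: mellin_conv_eq_mellin_sum)
qed

lemma smeasure_eqI_continuous:
  assumes eq: "\<And>\<phi>. continuous_on UNIV \<phi> \<Longrightarrow> bounded (range \<phi>) \<Longrightarrow> sintegral \<mu> \<phi> = sintegral \<nu> \<phi>"
  shows "\<mu> = \<nu>"
proof -
  define \<delta> where "\<delta> = \<mu> + - \<nu>"
  interpret p: finite_measure "pos_part \<delta>" by (rule finite_pos_part)
  interpret n: finite_measure "neg_part \<delta>" by (rule finite_neg_part)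
  have zero: "sintegral \<delta> \<phi> = 0" if \<phi>: "continuous_on UNIV \<phi>" "\<And>x. \<bar>\<phi> x\<bar> \<le> B" for \<phi> B
  proof -
    have "\<phi> \<in> borel_measurable borel" by (rule borel_measurable_continuous_onI) (rule \<phi>)
    then have "sintegrable \<mu> \<phi>" "sintegrable (- \<nu>) \<phi>" using \<phi>(2) by (auto intro: sintegrable_bounded)
    moreover have "sintegral \<mu> \<phi> = sintegral \<nu> \<phi>" using \<phi> by (intro eq) (auto simp: bounded_iff)
    ultimately show ?thesis unfolding \<delta>_def by (subst sintegral_add) (simp_all add: sintegral_uminus)
  qed
  have "pos_part \<delta> = neg_part \<delta>"
  proof (rule measure_eqI_lessThan)
    fix x :: real
    define g where "g n t = min 1 (max 0 (real n * (t - x)))" for n t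
    have g_cont: "continuous_on UNIV (g n)" for n unfolding g_def by (intro continuous_intros)
    have g_bd: "\<bar>g n t\<bar> \<le> 1" for n t by (auto simp: g_def)
    have g_lim: "(\<lambda>n. g n t) \<longlonglongrightarrow> indicator {x<..} t" for t
    proof (cases "x < t")
      case True
      then obtain N where N: "1 < real N * (t - x)"
        using reals_Archimedean3[of "t - x"] by auto
      have "g n t = 1" if "N \<le> n" for n
      proof -
        have "real N * (t - x) \<le> real n * (t - x)" using that True by (intro mult_right_mono) auto
        with N show ?thesis by (simp add: g_def)
      qed
      then have "\<forall>\<^sub>F n in sequentially. g n t = indicator {x<..} t"
        using True unfolding eventually_sequentially by auto
      then show ?thesis by (rule tendsto_eventually)
    next
      case False
      then have "g n t = 0" for n by (simp add: g_def mult_nonneg_nonpos)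
      with False show ?thesis by simp
    qed
    have g_m: "g n \<in> borel_measurable borel" for n
      by (rule borel_measurable_continuous_onI) (rule g_cont)
    have P: "(\<lambda>n. \<integral>t. g n t \<partial>pos_part \<delta>) \<longlonglongrightarrow> (\<integral>t. indicator {x<..} t \<partial>pos_part \<delta>)"
      by (rule integral_dominated_convergence[where w = "\<lambda>_. 1"])
        (use g_m g_bd g_lim in \<open>auto simp: measurable_pos_part\<close>)
    have N: "(\<lambda>n. \<integral>t. g n t \<partial>neg_part \<delta>) \<longlonglongrightarrow> (\<integral>t. indicator {x<..} t \<partial>neg_part \<delta>)"
      by (rule integral_dominated_convergence[where w = "\<lambda>_. 1"])
        (use g_m g_bd g_lim in \<open>auto simp: measurable_neg_part\<close>)
    have "(\<integral>t. g n t \<partial>pos_part \<delta>) = (\<integral>t. g n t \<partial>neg_part \<delta>)" for n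
      using zero[OF g_cont g_bd] by (simp add: sintegral_def)
    with P N have "(\<integral>t. indicator {x<..} t \<partial>pos_part \<delta>) = (\<integral>t. indicator {x<..} t \<partial>neg_part \<delta> :: real)"
      by (simp add: LIMSEQ_unique)
    then show "emeasure (pos_part \<delta>) {x<..} = emeasure (neg_part \<delta>) {x<..}"
      by (simp add: p.emeasure_eq_measure n.emeasure_eq_measure)
    show "emeasure (pos_part \<delta>) {x<..} < \<infinity>" by (simp add: p.emeasure_eq_measure)
  qed simp_all
  then have "smeas \<delta> A = 0" for A by (simp add: smeas_Jordan)
  then show ?thesis by (intro smeasure_eqI) (simp add: \<delta>_def)
qed

text \<open>Test functions are taken in C(R) instead of C([0,\<infinity>)): both families have the same restrictions
  to \<open>[0,\<infinity>)\<close>, and the measures do not charge the negative half-line.\<close>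

theorem mellin_conv_characterization:
  assumes \<mu>: "ssupport \<mu> \<subseteq> {0..a}" and \<nu>: "ssupport \<nu> \<subseteq> {0..b}"
  shows "\<rho> = mellin_conv \<mu> \<nu> \<longleftrightarrow>
    (\<forall>\<phi>. continuous_on UNIV \<phi> \<longrightarrow> sintegral \<rho> \<phi> = sintegral \<nu> (\<lambda>y. sintegral \<mu> (\<lambda>x. \<phi> (x * y))))"
proof
  assume "\<forall>\<phi>. continuous_on UNIV \<phi> \<longrightarrow> sintegral \<rho> \<phi> = sintegral \<nu> (\<lambda>y. sintegral \<mu> (\<lambda>x. \<phi> (x * y)))"
  then show "\<rho> = mellin_conv \<mu> \<nu>"
    by (intro smeasure_eqI_continuous) (simp add: sintegral_mellin_conv[OF \<mu> \<nu>])
qed (simp add: sintegral_mellin_conv[OF \<mu> \<nu>])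

definition snonneg :: "smeasure \<Rightarrow> bool" where
  "snonneg \<nu> \<longleftrightarrow> (\<forall>A\<in>sets borel. 0 \<le> smeas \<nu> A)"

text \<open>\<open>x\<^sup>\<gamma>\<close> with \<open>0\<^sup>0 = 1\<close>, whereas \<open>0 powr 0 = 0\<close>; the difference matters when \<open>\<gamma> = 0\<close> and the
  initial datum has an atom at 0.\<close>

definition rpow :: "real \<Rightarrow> real \<Rightarrow> real" where
  "rpow x \<gamma> = (if \<gamma> = 0 then 1 else x powr \<gamma>)"

text \<open>The total mass \<open>N\<close> of \<open>\<kappa>\<close> is finite because every \<^typ>\<open>smeasure\<close> is.\<close>

definition fragmentation_kernel :: "smeasure \<Rightarrow> bool" where
  "fragmentation_kernel \<kappa> \<longleftrightarrow>
     snonneg \<kappa> \<and> smeas \<kappa> {0} = 0 \<and> smeas \<kappa> {1} = 0 \<and> ssupport \<kappa> \<subseteq> {0..1} \<and>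
     sintegral \<kappa> (\<lambda>z. z * indicator {0..1} z) = 1"

definition admissible_datum :: "smeasure \<Rightarrow> bool" where
  "admissible_datum \<mu>\<^sub>0 \<longleftrightarrow> snonneg \<mu>\<^sub>0 \<and> (\<exists>L. ssupport \<mu>\<^sub>0 \<subseteq> {0..L})"

primrec frag_coeff :: "real \<Rightarrow> smeasure \<Rightarrow> nat \<Rightarrow> smeasure" where
  "frag_coeff \<gamma> \<kappa> 0 = 0"
| "frag_coeff \<gamma> \<kappa> (Suc n) = (1 / real (n + 1)) *\<^sub>R
     (- sdensity (\<lambda>x. rpow x \<gamma>) (frag_coeff \<gamma> \<kappa> n)
      + mellin_conv \<kappa> (sdensity (\<lambda>y. rpow y \<gamma>) (frag_coeff \<gamma> \<kappa> n))
      + ((- 1) ^ n / fact n) *\<^sub>R \<kappa>)"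

definition datum_moment :: "real \<Rightarrow> smeasure \<Rightarrow> nat \<Rightarrow> smeasure" where
  "datum_moment \<gamma> \<mu>\<^sub>0 n = sdensity (\<lambda>l. rpow l (real n * \<gamma>)) \<mu>\<^sub>0"

definition frag_term :: "real \<Rightarrow> real \<Rightarrow> smeasure \<Rightarrow> smeasure \<Rightarrow> real \<Rightarrow> nat \<Rightarrow> smeasure" where
  "frag_term \<alpha> \<gamma> \<kappa> \<mu>\<^sub>0 t n =
     (\<alpha> * t) ^ n *\<^sub>R mellin_conv (frag_coeff \<gamma> \<kappa> n) (datum_moment \<gamma> \<mu>\<^sub>0 n)"

definition frag_solution :: "real \<Rightarrow> real \<Rightarrow> smeasure \<Rightarrow> smeasure \<Rightarrow> real \<Rightarrow> smeasure" where
  "frag_solution \<alpha> \<gamma> \<kappa> \<mu>\<^sub>0 t =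
     sdensity (\<lambda>x. exp (- \<alpha> * rpow x \<gamma> * t)) \<mu>\<^sub>0 + (\<Sum>n. frag_term \<alpha> \<gamma> \<kappa> \<mu>\<^sub>0 t n)"

end

theory Submission
  imports Defs
begin

text \<open>
Write \<open>a\<^sub>n\<close> for \<open>frag_coeff \<gamma> \<kappa> n\<close> and \<open>A(s) = \<Sum>n. s\<^sup>n a\<^sub>n\<close>, a power series with values in the
measures on \<open>[0,1]\<close>. The recursion for \<open>a\<^sub>n\<close> says that
\<open>A' = - x\<^sup>\<gamma> A + \<kappa> * (x\<^sup>\<gamma> A) + e\<^sup>-\<^sup>s \<kappa>\<close> and \<open>A(0) = 0\<close>, so that \<open>e\<^sup>-\<^sup>s \<delta>\<^sub>1 + A(s)\<close> is the solution of the
fragmentation equation (in rescaled time \<open>s\<close>) started from a unit mass at 1. Because of the loss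
term \<open>- x\<^sup>\<gamma> A\<close> and the signs in \<open>e\<^sup>-\<^sup>s\<close>, the \<open>a\<^sub>n\<close> need not be non-negative. An exponential factor absorbs both: the
function \<open>V(s) = e\<^sup>s A(s)\<close> solves \<open>V' = (1 - x\<^sup>\<gamma>) V + \<kappa> * (x\<^sup>\<gamma> V) + \<kappa>\<close> and \<open>V(0) = 0\<close>. On \<open>[0,1]\<close> the
weights \<open>x\<^sup>\<gamma>\<close> and \<open>1 - x\<^sup>\<gamma>\<close> are both non-negative, and so is \<open>\<kappa>\<close>; hence every Taylor coefficient
\<open>v\<^sub>n\<close> of \<open>V\<close> is a non-negative measure (\<open>snonneg_frag_exp_coeff\<close>). The relation \<open>A = e\<^sup>-\<^sup>s V\<close> is proved
on the level of coefficients, \<open>a\<^sub>n = \<Sum>k\<le>n. (-1)\<^sup>n\<^sup>-\<^sup>k / (n-k)! v\<^sub>k\<close> (\<open>frag_coeff_eq_sum\<close>). It gives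
\<open>A(s) \<ge> 0\<close> for \<open>s \<ge> 0\<close> (\<open>frag_coeff_series_nonneg\<close>) and, from \<open>\<parallel>v\<^sub>n\<parallel> \<le> (1 + N)\<^sup>n / n!\<close>, the bound
\<open>\<parallel>a\<^sub>n\<parallel> \<le> (2 + N)\<^sup>n / n!\<close> (\<open>norm_frag_coeff\<close>), with \<open>N = \<parallel>\<kappa>\<parallel>\<close>.

A unit mass at \<open>l\<close> behaves like one at 1, with space scaled by \<open>l\<close> and time by \<open>l\<^sup>\<gamma>\<close>. This is what the
convolutions with \<open>b\<^sub>n = l\<^sup>n\<^sup>\<gamma> \<mu>\<^sub>0\<close> encode: exchanging sum and integral,
\<open>(\<Sum>n. (\<alpha>t)\<^sup>n a\<^sub>n * b\<^sub>n)(B) = \<integral> A(\<alpha> t l\<^sup>\<gamma>)({x. x l \<in> B}) d\<mu>\<^sub>0(l)\<close>,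
and the integrand is non-negative (\<open>frag_series_summable_and_nonneg\<close>). The bound on \<open>\<parallel>a\<^sub>n\<parallel>\<close> and the
compact support of \<open>\<mu>\<^sub>0\<close> justify the exchange and give the convergence in total variation.
\<close>

section \<open>Integration against signed measures\<close>

lemma sets_scaled_preimage [measurable]:
  "A \<in> sets borel \<Longrightarrow> (\<lambda>x::real. x * y) -` A \<in> sets borel"
  using measurable_sets_borel[of "\<lambda>x. x * y" borel A] by simp

lemma AE_parts_support:
  assumes S: "closed S" "ssupport \<nu> \<subseteq> S"
  shows "AE x in pos_part \<nu>. x \<in> S" "AE x in neg_part \<nu>. x \<in> S"
proof -
  have "AE x in p. x \<in> S"
    if p: "finite_measure p" "sets p = sets borel" "measure p (- S) = 0" for p :: "real measure"
  proof (rule AE_I[where N = "- S"])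
    show "emeasure p (- S) = 0" using p by (simp add: finite_measure.emeasure_eq_measure)
    show "- S \<in> sets p" using p(2) S(1) by auto
  qed auto
  then show "AE x in pos_part \<nu>. x \<in> S" "AE x in neg_part \<nu>. x \<in> S"
    using parts_null_outside_support[OF S] finite_pos_part finite_neg_part by simp_all
qed

lemma sintegral_cong_support:
  assumes S: "closed S" "ssupport \<nu> \<subseteq> S"
    and f: "f \<in> borel_measurable borel" and g: "g \<in> borel_measurable borel"
    and eq: "\<And>x. x \<in> S \<Longrightarrow> f x = g x"
  shows "sintegral \<nu> f = sintegral \<nu> g"
proof -
  have "(\<integral>x. f x \<partial>pos_part \<nu>) = (\<integral>x. g x \<partial>pos_part \<nu>)"
    using AE_parts_support(1)[OF S] f g
    by (intro integral_cong_AE) (auto simp: measurable_pos_part elim!: eventually_mono intro: eq)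
  moreover have "(\<integral>x. f x \<partial>neg_part \<nu>) = (\<integral>x. g x \<partial>neg_part \<nu>)"
    using AE_parts_support(2)[OF S] f g
    by (intro integral_cong_AE) (auto simp: measurable_neg_part elim!: eventually_mono intro: eq)
  ultimately show ?thesis by (simp add: sintegral_def)
qed

lemma sdensity_cong_support:
  assumes "closed S" "ssupport \<nu> \<subseteq> S"
    and [measurable]: "f \<in> borel_measurable borel" "g \<in> borel_measurable borel"
    and eq: "\<And>x. x \<in> S \<Longrightarrow> f x = g x"
  shows "sdensity f \<nu> = sdensity g \<nu>"
proof -
  have "(if A \<in> sets borel then sintegral \<nu> (\<lambda>x. f x * indicator A x) else 0) =
        (if A \<in> sets borel then sintegral \<nu> (\<lambda>x. g x * indicator A x) else 0)" for A
    using eq by (auto intro!: sintegral_cong_support[OF assms(1,2)])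
  then show ?thesis unfolding sdensity_def by presburger
qed

lemma sintegrable_bounded_support:
  assumes S: "closed S" "ssupport \<nu> \<subseteq> S" and f: "f \<in> borel_measurable borel"
    and B: "\<And>x. x \<in> S \<Longrightarrow> \<bar>f x\<bar> \<le> B"
  shows "sintegrable \<nu> f"
proof -
  interpret p: finite_measure "pos_part \<nu>" by (rule finite_pos_part)
  interpret n: finite_measure "neg_part \<nu>" by (rule finite_neg_part)
  have "integrable (pos_part \<nu>) f"
    using f AE_parts_support(1)[OF S]
    by (intro p.integrable_const_bound[of _ B])
      (auto simp: measurable_pos_part elim!: eventually_mono intro: B)
  moreover have "integrable (neg_part \<nu>) f"
    using f AE_parts_support(2)[OF S]
    by (intro n.integrable_const_bound[of _ B])
      (auto simp: measurable_neg_part elim!: eventually_mono intro: B)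
  ultimately show ?thesis by (simp add: sintegrable_def)
qed

text \<open>A density on a signed measure acts separately on its two Jordan parts, provided that it is
non-negative.\<close>

lemma pmeas_density:
  assumes M: "pmeas M" and f: "integrable M f" and nn: "\<And>x. 0 \<le> f x"
  shows "pmeas (density M f)"
    and "A \<in> sets borel \<Longrightarrow> measure (density M f) A = (\<integral>x. f x * indicator A x \<partial>M)"
proof -
  have e: "emeasure (density M f) A = ennreal (\<integral>x. f x * indicator A x \<partial>M)"
    if A: "A \<in> sets borel" for A
  proof -
    have "emeasure (density M f) A = (\<integral>\<^sup>+x. ennreal (f x) * indicator A x \<partial>M)"
      using f A pmeasD(2)[OF M] by (intro emeasure_density) auto
    also have "\<dots> = (\<integral>\<^sup>+x. ennreal (f x * indicator A x) \<partial>M)"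
      by (intro nn_integral_cong) (simp add: indicator_def)
    also have "\<dots> = ennreal (\<integral>x. f x * indicator A x \<partial>M)"
      using integrable_indicator_pmeas(1)[OF M f A] nn by (intro nn_integral_eq_integral) auto
    finally show ?thesis .
  qed
  then show m: "measure (density M f) A = (\<integral>x. f x * indicator A x \<partial>M)"
    if "A \<in> sets borel" for A
    using that nn by (simp add: measure_def integral_nonneg)
  have "finite_measure (density M f)"
    using e[of UNIV] pmeasD(3)[OF M] by (intro finite_measureI) (simp only: space_density; simp)
  moreover have "measure (density M f) {..<0} = 0"
    using integrable_indicator_pmeas(2)[OF M f, of "{..<0}"] m[of "{..<0}"]
    by (simp add: disjoint_iff not_le)
  ultimately show "pmeas (density M f)"
    using pmeasD(2)[OF M] by (simp add: pmeas_def)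
qed

text \<open>The decomposition of \<open>f \<nu>\<close> into \<open>f \<nu>\<^sup>+\<close> and \<open>f \<nu>\<^sup>-\<close> reduces the claim to densities of finite
positive measures.\<close>

lemma sintegral_sdensity:
  assumes f: "sintegrable \<nu> f" and nn: "\<And>x. 0 \<le> f x"
    and g: "g \<in> borel_measurable borel" and fg: "sintegrable \<nu> (\<lambda>x. f x * g x)"
  shows "sintegral (sdensity f \<nu>) g = sintegral \<nu> (\<lambda>x. f x * g x)"
proof -
  let ?P = "density (pos_part \<nu>) f" and ?N = "density (neg_part \<nu>) f"
  have fp: "integrable (pos_part \<nu>) f" and fn: "integrable (neg_part \<nu>) f"
    using f by (simp_all add: sintegrable_def)
  note P = pmeas_density[OF pmeas_pos_part fp nn] and N = pmeas_density[OF pmeas_neg_part fn nn]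
  have eq: "sdensity f \<nu> = smeas_of ?P + - smeas_of ?N"
    using P N by (intro smeasure_eqI) (simp add: smeas_sdensity[OF f] sintegral_def)
  have gP: "integrable ?P g" "(\<integral>x. g x \<partial>?P) = (\<integral>x. f x * g x \<partial>pos_part \<nu>)"
    using fp fg g nn by (simp_all add: integrable_density integral_density measurable_pos_part sintegrable_def)
  have gN: "integrable ?N g" "(\<integral>x. g x \<partial>?N) = (\<integral>x. f x * g x \<partial>neg_part \<nu>)"
    using fn fg g nn by (simp_all add: integrable_density integral_density measurable_neg_part sintegrable_def)
  have i: "sintegrable (smeas_of ?P) g" "sintegrable (- smeas_of ?N) g"
    using sintegrable_smeas_of[OF P(1) gP(1)] sintegrable_smeas_of[OF N(1) gN(1)]
    by (simp_all add: sintegrable_uminus)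
  show "sintegral (sdensity f \<nu>) g = sintegral \<nu> (\<lambda>x. f x * g x)"
    unfolding eq sintegral_add[OF i]
    unfolding sintegral_uminus sintegral_smeas_of[OF P(1) gP(1)] sintegral_smeas_of[OF N(1) gN(1)] gP(2) gN(2)
    by (simp add: sintegral_def)
qed

lemma sintegral_cmult: "sintegral \<nu> (\<lambda>x. c * f x) = c * sintegral \<nu> f"
  by (simp add: sintegral_def right_diff_distrib)

text \<open>For \<open>c \<ge> 0\<close> the measure \<open>c \<nu>\<close> is \<open>\<nu>\<close> with the constant density \<open>c\<close>; a sign change covers the
rest.\<close>

lemma sintegral_scaleR:
  assumes f: "sintegrable \<nu> f"
  shows "sintegral (c *\<^sub>R \<nu>) f = c * sintegral \<nu> f"
proof -
  have pos: "sintegral (d *\<^sub>R \<nu>) f = d * sintegral \<nu> f" if "0 \<le> d" for d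
  proof -
    have d: "sintegrable \<nu> (\<lambda>_. d)" by (rule sintegrable_bounded) auto
    have eq: "d *\<^sub>R \<nu> = sdensity (\<lambda>_. d) \<nu>"
      by (rule smeasure_eqI) (simp add: smeas_sdensity[OF d] sintegral_cmult sintegral_indicator)
    have "sintegrable \<nu> (\<lambda>x. d * f x)" using f by (simp add: sintegrable_def)
    then show ?thesis
      unfolding eq using sintegral_sdensity[OF d that sintegrable_measurable[OF f]]
      by (simp add: sintegral_cmult)
  qed
  show ?thesis
  proof (cases "0 \<le> c")
    case False
    then have "sintegral (- ((- c) *\<^sub>R \<nu>)) f = c * sintegral \<nu> f"
      unfolding sintegral_uminus by (subst pos) auto
    then show ?thesis by simp
  qed (rule pos)
qed

text \<open>The bound on \<open>f\<close> is imposed on the whole line: then \<open>f\<close> is integrable for every measure, and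
linearity holds on the whole space instead of a subspace of measures with restricted support.\<close>

lemma linear_sdensity:
  assumes [measurable]: "f \<in> borel_measurable borel" and B: "\<And>x. \<bar>f x\<bar> \<le> B"
  shows "linear (sdensity f)"
proof -
  have f: "sintegrable \<nu> f" for \<nu> by (rule sintegrable_bounded) (use B in auto)
  have fi: "sintegrable \<nu> (\<lambda>x. f x * indicator A x)" if [measurable]: "A \<in> sets borel" for \<nu> A
    by (rule sintegrable_bounded[where B = B])
      (use B abs_ge_zero[THEN order_trans, OF B] in \<open>auto simp: indicator_def\<close>)
  show ?thesis
    by (intro linearI smeasure_eqI) (simp_all add: smeas_sdensity[OF f] sintegral_add sintegral_scaleR fi)
qed

section \<open>Mellin convolution\<close>

text \<open>The set of all \<open>x\<close> with \<open>x y \<in> A\<close>, written as a preimage, plays the role of \<open>A / y\<close> and is also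
meaningful for \<open>y = 0\<close>. The mass of \<open>\<mu> * \<nu>\<close> in \<open>A\<close> is the \<open>\<nu>\<close>-average over \<open>y\<close> of the \<open>\<mu>\<close>-mass of
these sets.\<close>

lemma indicator_scaled_preimage:
  "indicator ((\<lambda>x. x * y) -` A) = (\<lambda>x::real. indicator A (x * y) :: real)"
  by (auto simp: indicator_def fun_eq_iff)

lemma borel_measurable_smeas_scaled_preimage [measurable]:
  assumes [measurable]: "A \<in> sets borel"
  shows "(\<lambda>y. smeas \<mu> ((\<lambda>x. x * y) -` A)) \<in> borel_measurable borel"
proof -
  have "(\<lambda>y. \<integral>x. (indicator A (x * y) :: real) \<partial>p) \<in> borel_measurable borel"
    if p: "finite_measure p" "sets p = sets borel" for p :: "real measure"
  proof -
    interpret finite_measure p by fact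
    note [measurable_cong] = p(2)
    show ?thesis by measurable
  qed
  from this[OF finite_pos_part sets_pos_part] this[OF finite_neg_part sets_neg_part]
  have "(\<lambda>y. sintegral \<mu> (indicator ((\<lambda>x. x * y) -` A))) \<in> borel_measurable borel"
    unfolding sintegral_def indicator_scaled_preimage by measurable
  then show ?thesis by (simp add: sintegral_indicator)
qed

lemma smeas_mellin_conv_preimage:
  assumes "A \<in> sets borel"
  shows "smeas (mellin_conv \<mu> \<nu>) A = sintegral \<nu> (\<lambda>y. smeas \<mu> ((\<lambda>x. x * y) -` A))"
proof -
  have "sintegral \<mu> (\<lambda>x. indicator A (x * y)) = smeas \<mu> ((\<lambda>x. x * y) -` A)" for y
    using sintegral_indicator[OF sets_scaled_preimage[OF assms], of \<mu> y]
    by (simp only: indicator_scaled_preimage)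
  then show ?thesis by (simp add: smeas_mellin_conv[OF assms])
qed

lemma sintegrable_smeas_scaled_preimage:
  "A \<in> sets borel \<Longrightarrow> sintegrable \<nu> (\<lambda>y. smeas \<mu> ((\<lambda>x. x * y) -` A))"
  by (rule sintegrable_bounded[where B = "norm \<mu>"]) (auto simp: smeas_le_norm)

lemma linear_mellin_conv: "linear (mellin_conv \<mu>)"
  by (intro linearI smeasure_eqI)
    (simp_all add: smeas_mellin_conv_preimage sintegral_add sintegral_scaleR
      sintegrable_smeas_scaled_preimage)

lemma ssupport_mellin_conv:
  assumes \<mu>: "ssupport \<mu> \<subseteq> {0..a}" and \<nu>: "ssupport \<nu> \<subseteq> {0..b}"
  shows "ssupport (mellin_conv \<mu> \<nu>) \<subseteq> {0..a * b}"
proof -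
  have "smeas (mellin_conv \<mu> \<nu>) A = 0" if A: "A \<in> sets borel" "A \<inter> {0..a * b} = {}" for A
  proof -
    have "smeas \<mu> ((\<lambda>x. x * y) -` A) = 0" if y: "y \<in> {0..b}" for y
    proof -
      have "x * y \<in> {0..a * b}" if "x \<in> {0..a}" for x using y that by (auto intro: mult_mono)
      with A(2) have "((\<lambda>x. x * y) -` A) \<inter> {0..a} = {}" by auto
      with \<mu> sets_scaled_preimage[OF A(1)] show ?thesis by (simp add: ssupport_subset_iff)
    qed
    then have "sintegral \<nu> (\<lambda>y. smeas \<mu> ((\<lambda>x. x * y) -` A)) = sintegral \<nu> (\<lambda>_. 0)"
      using A(1) \<nu> by (intro sintegral_cong_support[of "{0..b}"]) auto
    then show ?thesis by (simp add: smeas_mellin_conv_preimage[OF A(1)] sintegral_def)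
  qed
  then show ?thesis by (simp add: ssupport_subset_iff)
qed

section \<open>Non-negative measures\<close>

lemma emeasure_neg_part_snonneg:
  assumes "snonneg \<nu>"
  shows "emeasure (neg_part \<nu>) UNIV = 0"
proof -
  have "emeasure (pos_part (- \<nu>)) UNIV \<le> emeasure (null_measure (borel :: real measure)) UNIV"
    using assms by (intro pos_part_least) (auto intro!: finite_measureI simp: snonneg_def)
  then show ?thesis by (simp add: neg_part_def)
qed

lemma measure_pos_part_snonneg:
  assumes "snonneg \<nu>" "A \<in> sets borel"
  shows "measure (pos_part \<nu>) A = smeas \<nu> A"
proof -
  have "measure (neg_part \<nu>) A \<le> measure (neg_part \<nu>) UNIV"
    using assms(2) by (intro finite_measure.finite_measure_mono finite_neg_part) auto
  also have "\<dots> = 0" using emeasure_neg_part_snonneg[OF assms(1)] by (simp add: measure_def)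
  finally have "measure (neg_part \<nu>) A = 0" by (simp add: measure_le_0_iff)
  then show ?thesis by (simp add: smeas_Jordan)
qed

lemma sintegral_snonneg:
  assumes "snonneg \<nu>"
  shows "sintegral \<nu> f = (\<integral>x. f x \<partial>pos_part \<nu>)"
proof -
  have "AE x in neg_part \<nu>. f x = 0"
    by (rule AE_I[where N = UNIV]) (use emeasure_neg_part_snonneg[OF assms] in auto)
  then have "(\<integral>x. f x \<partial>neg_part \<nu>) = 0" by (rule integral_eq_zero_AE)
  then show ?thesis by (simp add: sintegral_def)
qed

lemma sintegral_nonneg: "snonneg \<nu> \<Longrightarrow> (\<And>x. 0 \<le> f x) \<Longrightarrow> 0 \<le> sintegral \<nu> f"
  by (simp add: sintegral_snonneg)

lemma sintegral_mono_support:
  assumes "snonneg \<nu>" "closed S" "ssupport \<nu> \<subseteq> S" "sintegrable \<nu> f" "sintegrable \<nu> g"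
    and le: "\<And>x. x \<in> S \<Longrightarrow> f x \<le> g x"
  shows "sintegral \<nu> f \<le> sintegral \<nu> g"
  unfolding sintegral_snonneg[OF assms(1)]
  using AE_parts_support(1)[OF assms(2,3)] assms(4,5)
  by (intro integral_mono_AE) (auto simp: sintegrable_def elim!: eventually_mono intro: le)

lemma snonneg_sdensity:
  assumes "snonneg \<nu>" "sintegrable \<nu> f" "\<And>x. 0 \<le> f x"
  shows "snonneg (sdensity f \<nu>)"
  unfolding snonneg_def using assms by (auto simp: smeas_sdensity intro!: sintegral_nonneg)

lemma snonneg_mellin_conv:
  assumes "snonneg \<mu>" "snonneg \<nu>"
  shows "snonneg (mellin_conv \<mu> \<nu>)"
  unfolding snonneg_def using assms(1)
  by (auto simp: smeas_mellin_conv_preimage snonneg_def intro!: sintegral_nonneg[OF assms(2)]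
      sets_scaled_preimage)

text \<open>For a non-negative measure the sum over a disjoint family is the mass of its union.\<close>

lemma norm_snonneg:
  assumes \<nu>: "snonneg \<nu>"
  shows "norm \<nu> = smeas \<nu> UNIV"
proof (rule antisym)
  show "norm \<nu> \<le> smeas \<nu> UNIV"
  proof (rule norm_smeasure_leI)
    fix \<P> assume p: "\<P> \<in> borel_families"
    then have "\<Union>\<P> \<in> sets borel" by (auto simp: borel_families_def)
    have "(\<Sum>A\<in>\<P>. \<bar>smeas \<nu> A\<bar>) = (\<Sum>A\<in>\<P>. smeas \<nu> A)"
      using p \<nu> by (intro sum.cong) (auto simp: borel_families_def snonneg_def)
    also have "\<dots> = smeas \<nu> (\<Union>\<P>)" by (rule smeas_Union[OF p, symmetric])
    also have "\<dots> \<le> smeas \<nu> UNIV"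
      using \<nu> \<open>\<Union>\<P> \<in> sets borel\<close> by (intro positive_set_mono) (auto simp: positive_set_def snonneg_def)
    finally show "(\<Sum>A\<in>\<P>. \<bar>smeas \<nu> A\<bar>) \<le> smeas \<nu> UNIV" .
  qed
  show "smeas \<nu> UNIV \<le> norm \<nu>" using smeas_le_norm[of \<nu> UNIV] by simp
qed

lemma norm_sdensity_snonneg:
  assumes \<nu>: "snonneg \<nu>" and S: "closed S" "ssupport \<nu> \<subseteq> S"
    and f: "f \<in> borel_measurable borel" "\<And>x. 0 \<le> f x" "\<And>x. x \<in> S \<Longrightarrow> f x \<le> B"
  shows "norm (sdensity f \<nu>) \<le> B * norm \<nu>"
proof -
  have i: "sintegrable \<nu> f" using f by (intro sintegrable_bounded_support[OF S]) auto
  have "norm (sdensity f \<nu>) = sintegral \<nu> f"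
    using norm_snonneg[OF snonneg_sdensity[OF \<nu> i f(2)]] smeas_sdensity[OF i, of UNIV] by simp
  also have "\<dots> \<le> sintegral \<nu> (\<lambda>x. B * indicator UNIV x)"
    using f i sintegrable_bounded[of "\<lambda>_. B" "\<bar>B\<bar>" \<nu>]
    by (intro sintegral_mono_support[OF \<nu> S]) auto
  also have "\<dots> = B * norm \<nu>" 
    using sintegral_indicator[of UNIV \<nu>] sintegral_cmult[of \<nu> B "\<lambda>_. 1"]
    by (simp add: norm_snonneg \<nu>)
  finally show ?thesis .
qed

text \<open>For fixed \<open>y\<close> the preimages of a disjoint family under \<open>x \<mapsto> x y\<close> are again disjoint, so their
\<open>\<mu>\<close>-masses add up to at most \<open>\<parallel>\<mu>\<parallel>\<close> in absolute value; integrating over \<open>y\<close> gives the factor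
\<open>\<parallel>\<nu>\<parallel>\<close>.\<close>

lemma norm_mellin_conv_le:
  assumes \<nu>: "snonneg \<nu>"
  shows "norm (mellin_conv \<mu> \<nu>) \<le> norm \<mu> * norm \<nu>"
proof (rule norm_smeasure_leI)
  fix \<P> assume p: "\<P> \<in> borel_families"
  then have fin: "finite \<P>" and b: "\<And>A. A \<in> \<P> \<Longrightarrow> A \<in> sets borel"
    and d: "\<And>A B z. A \<in> \<P> \<Longrightarrow> B \<in> \<P> \<Longrightarrow> z \<in> A \<Longrightarrow> z \<in> B \<Longrightarrow> A = B"
    by (auto simp: borel_families_def disjoint_def)
  let ?s = "\<lambda>A y. smeas \<mu> ((\<lambda>x. x * y) -` A)"
  interpret finite_measure "pos_part \<nu>" by (rule finite_pos_part)
  have i: "integrable (pos_part \<nu>) (?s A)" if "A \<in> \<P>" for A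
    using sintegrable_smeas_scaled_preimage[OF b[OF that]] by (simp add: sintegrable_def)
  have "(\<Sum>A\<in>\<P>. \<bar>smeas (mellin_conv \<mu> \<nu>) A\<bar>) = (\<Sum>A\<in>\<P>. \<bar>\<integral>y. ?s A y \<partial>pos_part \<nu>\<bar>)"
    using b by (simp add: smeas_mellin_conv_preimage sintegral_snonneg[OF \<nu>])
  also have "\<dots> \<le> (\<Sum>A\<in>\<P>. \<integral>y. \<bar>?s A y\<bar> \<partial>pos_part \<nu>)"
    by (intro sum_mono) (use integral_norm_bound in \<open>simp flip: real_norm_def\<close>)
  also have "\<dots> = (\<integral>y. (\<Sum>A\<in>\<P>. \<bar>?s A y\<bar>) \<partial>pos_part \<nu>)"
    using i by (intro Bochner_Integration.integral_sum[symmetric]) simp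
  also have "\<dots> \<le> (\<integral>y. norm \<mu> \<partial>pos_part \<nu>)"
  proof (rule integral_mono)
    fix y
    \<comment> \<open>Distinct members of the family can have the same preimage, but only the empty one,
      where \<open>\<mu>\<close> vanishes.\<close>
    let ?Q = "(\<lambda>A. (\<lambda>x. x * y) -` A) ` \<P>"
    have "?Q \<in> borel_families"
      using fin b by (auto simp: borel_families_def disjoint_def dest: d)
    moreover have "(\<Sum>A\<in>\<P>. \<bar>?s A y\<bar>) = (\<Sum>B\<in>?Q. \<bar>smeas \<mu> B\<bar>)"
    proof (rule sum.reindex_nontrivial[OF fin, symmetric, unfolded comp_def])
      fix A B assume AB: "A \<in> \<P>" "B \<in> \<P>" "A \<noteq> B" "(\<lambda>x. x * y) -` A = (\<lambda>x. x * y) -` B"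
      then have "A \<inter> B = {}" using d by blast
      with AB(4) have "(\<lambda>x. x * y) -` A = {}" by blast
      then show "\<bar>?s A y\<bar> = 0" by simp
    qed
    ultimately show "(\<Sum>A\<in>\<P>. \<bar>?s A y\<bar>) \<le> norm \<mu>" using variation_le_norm[of ?Q \<mu>] by simp
  qed (use i in auto)
  also have "\<dots> = norm \<mu> * norm \<nu>"
    using measure_pos_part_snonneg[OF \<nu>, of UNIV] by (simp add: norm_snonneg[OF \<nu>])
  finally show "(\<Sum>A\<in>\<P>. \<bar>smeas (mellin_conv \<mu> \<nu>) A\<bar>) \<le> norm \<mu> * norm \<nu>" .
qed

section \<open>The weight \<open>x\<^sup>\<gamma>\<close>\<close>

lemma rpow_nonneg [simp]: "0 \<le> rpow x \<gamma>"
  by (simp add: rpow_def)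

lemma borel_measurable_rpow [measurable]: "(\<lambda>x. rpow x \<gamma>) \<in> borel_measurable borel"
  unfolding rpow_def by (cases "\<gamma> = 0") simp_all

lemma rpow_mono: "0 \<le> \<gamma> \<Longrightarrow> 0 \<le> x \<Longrightarrow> x \<le> L \<Longrightarrow> rpow x \<gamma> \<le> rpow L \<gamma>"
  by (auto simp: rpow_def intro: powr_mono2)

lemma rpow_of_nat_mult: "rpow x (real n * \<gamma>) = rpow x \<gamma> ^ n"
  by (cases "x = 0") (auto simp: rpow_def powr_power)

section \<open>Positivity of the power series of the fundamental solution\<close>

text \<open>The weight \<open>x\<^sup>\<gamma>\<close>, truncated at 1. It agrees with \<open>x\<^sup>\<gamma>\<close> on \<open>[0,1]\<close>, where the coefficients live,
but it and its complement to 1 are bounded and non-negative everywhere. Multiplication by either is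
therefore linear and positive on all measures, without support conditions.\<close>

definition unit_weight :: "real \<Rightarrow> real \<Rightarrow> real" where
  "unit_weight \<gamma> x = min 1 (rpow x \<gamma>)"

lemma unit_weight_bounds [simp]: "0 \<le> unit_weight \<gamma> x" "unit_weight \<gamma> x \<le> 1"
  by (auto simp: unit_weight_def)

lemma unit_weight_eq: "0 \<le> \<gamma> \<Longrightarrow> x \<in> {0..1} \<Longrightarrow> unit_weight \<gamma> x = rpow x \<gamma>"
  using rpow_mono[of \<gamma> x 1] by (auto simp: unit_weight_def rpow_def split: if_splits)

lemma borel_measurable_unit_weight [measurable]: "unit_weight \<gamma> \<in> borel_measurable borel"
  unfolding unit_weight_def by measurable

lemma sintegrable_unit_weight:
  "sintegrable \<nu> (unit_weight \<gamma>)" "sintegrable \<nu> (\<lambda>x. 1 - unit_weight \<gamma> x)"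
  by (auto intro!: sintegrable_bounded[where B = 1])

lemma linear_sdensity_unit_weight: "linear (sdensity (unit_weight \<gamma>))"
  by (rule linear_sdensity[where B = 1]) auto

lemma sdensity_one_minus_unit_weight:
  "sdensity (\<lambda>x. 1 - unit_weight \<gamma> x) \<nu> = \<nu> - sdensity (unit_weight \<gamma>) \<nu>"
proof (rule smeasure_eqI)
  fix A :: "real set" assume A [measurable]: "A \<in> sets borel"
  have i: "sintegrable \<nu> (indicator A)" "sintegrable \<nu> (\<lambda>x. unit_weight \<gamma> x * indicator A x)"
    by (auto intro!: sintegrable_bounded[where B = 1] simp: indicator_def)
  have "sintegral \<nu> (\<lambda>x. indicator A x - unit_weight \<gamma> x * indicator A x) =
    sintegral \<nu> (indicator A) - sintegral \<nu> (\<lambda>x. unit_weight \<gamma> x * indicator A x)"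
    using i by (simp add: sintegral_def sintegrable_def)
  then show "smeas (sdensity (\<lambda>x. 1 - unit_weight \<gamma> x) \<nu>) A = smeas (\<nu> - sdensity (unit_weight \<gamma>) \<nu>) A"
    by (simp add: smeas_sdensity sintegrable_unit_weight left_diff_distrib sintegral_indicator A)
qed

text \<open>The Taylor coefficients \<open>v\<^sub>n\<close> of \<open>V(s) = e\<^sup>s \<Sum>n. s\<^sup>n a\<^sub>n\<close>, read off from
\<open>V' = (1 - x\<^sup>\<gamma>) V + \<kappa> * (x\<^sup>\<gamma> V) + \<kappa>\<close>. The source \<open>\<kappa>\<close> does not depend on \<open>s\<close>, because \<open>e\<^sup>s\<close> cancels the
factor \<open>e\<^sup>-\<^sup>s\<close>, and so it enters only the coefficient of order one.\<close>

primrec frag_exp_coeff :: "real \<Rightarrow> smeasure \<Rightarrow> nat \<Rightarrow> smeasure" where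
  "frag_exp_coeff \<gamma> \<kappa> 0 = 0"
| "frag_exp_coeff \<gamma> \<kappa> (Suc n) = (1 / real (Suc n)) *\<^sub>R
     (sdensity (\<lambda>x. 1 - unit_weight \<gamma> x) (frag_exp_coeff \<gamma> \<kappa> n)
      + mellin_conv \<kappa> (sdensity (unit_weight \<gamma>) (frag_exp_coeff \<gamma> \<kappa> n))
      + (if n = 0 then \<kappa> else 0))"

lemma snonneg_frag_exp_coeff:
  assumes \<kappa>: "snonneg \<kappa>"
  shows "snonneg (frag_exp_coeff \<gamma> \<kappa> n)"
proof (induction n)
  case (Suc n)
  have "snonneg (sdensity (\<lambda>x. 1 - unit_weight \<gamma> x) (frag_exp_coeff \<gamma> \<kappa> n))"
    "snonneg (mellin_conv \<kappa> (sdensity (unit_weight \<gamma>) (frag_exp_coeff \<gamma> \<kappa> n)))"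
    by (auto intro!: snonneg_mellin_conv snonneg_sdensity \<kappa> Suc.IH sintegrable_unit_weight)
  with \<kappa> show ?case by (auto simp: snonneg_def)
qed (simp add: snonneg_def)

text \<open>Both weights are at most 1, so a step of the recursion multiplies the mass by at most
\<open>(1 + \<parallel>\<kappa>\<parallel>) / (n + 1)\<close>.\<close>

lemma norm_frag_exp_coeff:
  assumes \<kappa>: "snonneg \<kappa>"
  shows "norm (frag_exp_coeff \<gamma> \<kappa> n) \<le> (1 + norm \<kappa>) ^ n / fact n"
proof (induction n)
  case (Suc n)
  let ?v = "frag_exp_coeff \<gamma> \<kappa> n"
  have D: "norm (sdensity f ?v) \<le> norm ?v"
    if "f \<in> borel_measurable borel" "\<And>x. 0 \<le> f x" "\<And>x. f x \<le> 1" for f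
    using norm_sdensity_snonneg[OF snonneg_frag_exp_coeff[OF \<kappa>], of UNIV \<gamma> n f 1] that by simp
  have "snonneg (sdensity (unit_weight \<gamma>) ?v)"
    by (intro snonneg_sdensity snonneg_frag_exp_coeff \<kappa> sintegrable_unit_weight) simp
  from norm_mellin_conv_le[OF this, of \<kappa>] D[OF borel_measurable_unit_weight unit_weight_bounds, of \<gamma>]
  have M: "norm (mellin_conv \<kappa> (sdensity (unit_weight \<gamma>) ?v)) \<le> norm \<kappa> * norm ?v"
    by (meson mult_left_mono norm_ge_zero order_trans)
  have "norm (sdensity (\<lambda>x. 1 - unit_weight \<gamma> x) ?v + mellin_conv \<kappa> (sdensity (unit_weight \<gamma>) ?v)
      + (if n = 0 then \<kappa> else 0)) \<le> norm ?v + norm \<kappa> * norm ?v + norm (if n = 0 then \<kappa> else 0)"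
    by (intro norm_triangle_le add_mono D M) auto
  also have "\<dots> \<le> (1 + norm \<kappa>) * ((1 + norm \<kappa>) ^ n / fact n)"
  \<comment> \<open>The source appears only for \<open>n = 0\<close>, where \<open>v\<^sub>0 = 0\<close> leaves room for it in the bound \<open>1 + \<parallel>\<kappa>\<parallel>\<close>.\<close>
  proof (cases "n = 0")
    case False
    have "norm ?v + norm \<kappa> * norm ?v = (1 + norm \<kappa>) * norm ?v" by (simp add: algebra_simps)
    also have "\<dots> \<le> (1 + norm \<kappa>) * ((1 + norm \<kappa>) ^ n / fact n)"
      by (intro mult_left_mono Suc.IH) simp
    finally show ?thesis using False by simp
  qed simp
  finally show ?case by (simp add: divide_simps mult_ac)
qed simp

lemma ssupport_linear_combination:
  assumes "closed S" "ssupport \<mu> \<subseteq> S" "ssupport \<nu> \<subseteq> S"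
  shows "ssupport (\<mu> + \<nu>) \<subseteq> S" "ssupport (c *\<^sub>R \<nu>) \<subseteq> S" "ssupport (- \<nu>) \<subseteq> S"
  using assms by (simp_all add: ssupport_subset_iff)

lemma ssupport_sdensity:
  assumes "closed S" "ssupport \<nu> \<subseteq> S" and f: "sintegrable \<nu> f"
  shows "ssupport (sdensity f \<nu>) \<subseteq> S"
proof -
  have "smeas (sdensity f \<nu>) A = 0" if A: "A \<in> sets borel" "A \<inter> S = {}" for A
  proof -
    note [measurable] = sintegrable_measurable[OF f] A(1)
    have "sintegral \<nu> (\<lambda>x. f x * indicator A x) = sintegral \<nu> (\<lambda>_. 0)"
      using A(2) by (intro sintegral_cong_support[OF assms(1,2)]) (auto simp: indicator_def)
    then show ?thesis by (simp add: smeas_sdensity[OF f A(1)] sintegral_def)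
  qed
  then show ?thesis by (simp add: ssupport_subset_iff[OF assms(1)])
qed

lemma sdensity_rpow_eq_unit_weight:
  assumes "0 \<le> \<gamma>" "ssupport \<nu> \<subseteq> {0..1}"
  shows "sdensity (\<lambda>x. rpow x \<gamma>) \<nu> = sdensity (unit_weight \<gamma>) \<nu>"
  using assms by (intro sdensity_cong_support[of "{0..1}"]) (auto simp: unit_weight_eq)

lemma ssupport_frag_coeff:
  assumes \<gamma>: "0 \<le> \<gamma>" and \<kappa>: "ssupport \<kappa> \<subseteq> {0..1}"
  shows "ssupport (frag_coeff \<gamma> \<kappa> n) \<subseteq> {0..1}"
proof (induction n)
  case 0
  then show ?case by (simp add: ssupport_subset_iff)
next
  case (Suc n)
  have "ssupport (sdensity (unit_weight \<gamma>) (frag_coeff \<gamma> \<kappa> n)) \<subseteq> {0..1}"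
    by (intro ssupport_sdensity Suc sintegrable_unit_weight) simp
  with ssupport_mellin_conv[OF \<kappa> this] \<kappa> show ?case
    unfolding frag_coeff.simps sdensity_rpow_eq_unit_weight[OF \<gamma> Suc]
    by (intro ssupport_linear_combination) simp_all
qed

text \<open>The identity \<open>A(s) = e\<^sup>-\<^sup>s V(s)\<close> for formal power series. With \<open>D \<nu> = \<kappa> * (x\<^sup>\<gamma> \<nu>) - x\<^sup>\<gamma> \<nu>\<close> and
\<open>c\<^sub>j = (-1)\<^sup>j / j!\<close>, the recursions are \<open>(n+1) a\<^sub>n\<^sub>+\<^sub>1 = D a\<^sub>n + c\<^sub>n \<kappa>\<close> and
\<open>(k+1) v\<^sub>k\<^sub>+\<^sub>1 = v\<^sub>k + D v\<^sub>k\<close>, with an additional \<open>\<kappa>\<close> for \<open>k = 0\<close>. Applying \<open>D\<close> to the sum for \<open>a\<^sub>n\<close>, this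
\<open>\<kappa>\<close> cancels \<open>c\<^sub>n \<kappa>\<close>, and the rest is the product rule for \<open>e\<^sup>-\<^sup>s V\<close>.\<close>

lemma frag_coeff_eq_sum:
  assumes \<gamma>: "0 \<le> \<gamma>" and \<kappa>: "ssupport \<kappa> \<subseteq> {0..1}"
  shows "frag_coeff \<gamma> \<kappa> n = (\<Sum>k\<le>n. ((- 1) ^ (n - k) / fact (n - k)) *\<^sub>R frag_exp_coeff \<gamma> \<kappa> k)"
proof (induction n)
  case (Suc n)
  define c :: "nat \<Rightarrow> real" where "c j = (- 1) ^ j / fact j" for j
  define v where "v = frag_exp_coeff \<gamma> \<kappa>"
  define D where "D \<nu> = mellin_conv \<kappa> (sdensity (unit_weight \<gamma>) \<nu>) - sdensity (unit_weight \<gamma>) \<nu>" for \<nu>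
  have "linear D"
    unfolding D_def
    using linear_compose[OF linear_sdensity_unit_weight linear_mellin_conv, of \<kappa> \<gamma>]
    by (intro linear_compose_sub linear_sdensity_unit_weight) (simp add: comp_def)
  have c_rec: "real (Suc j) * c (Suc j) = - c j" for j
    by (simp add: c_def del: of_nat_Suc)
  have Dv: "D (v k) = real (Suc k) *\<^sub>R v (Suc k) - v k - (if k = 0 then \<kappa> else 0)" for k
    by (simp add: v_def D_def sdensity_one_minus_unit_weight)
  have "D (frag_coeff \<gamma> \<kappa> n) = (\<Sum>k\<le>n. c (n - k) *\<^sub>R D (v k))"
    unfolding Suc.IH c_def[symmetric] v_def[symmetric]
    using \<open>linear D\<close> by (simp add: linear_sum linear_scale)
  also have "\<dots> = (\<Sum>k\<le>n. c (n - k) *\<^sub>R (real (Suc k) *\<^sub>R v (Suc k))) - (\<Sum>k\<le>n. c (n - k) *\<^sub>R v k)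
      - (\<Sum>k\<le>n. if k = 0 then c (n - k) *\<^sub>R \<kappa> else 0)"
    unfolding Dv sum_subtractf[symmetric] by (intro sum.cong) (simp_all add: scaleR_diff_right)
  also have "(\<Sum>k\<le>n. if k = 0 then c (n - k) *\<^sub>R \<kappa> else 0) = c n *\<^sub>R \<kappa>" by simp
  \<comment> \<open>Both sums are extended to \<open>k \<le> n + 1\<close>: the new terms carry the factors \<open>k = 0\<close> and \<open>n + 1 - k = 0\<close>,
    and \<open>k + (n + 1 - k)\<close> recombines to the factor \<open>n + 1\<close>.\<close>
  also have "(\<Sum>k\<le>n. c (n - k) *\<^sub>R (real (Suc k) *\<^sub>R v (Suc k))) =
      (\<Sum>k\<le>Suc n. (real k * c (Suc n - k)) *\<^sub>R v k)"
    unfolding sum.atMost_Suc_shift by (simp add: mult.commute)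
  also have "(\<Sum>k\<le>n. c (n - k) *\<^sub>R v k) = - (\<Sum>k\<le>Suc n. (real (Suc n - k) * c (Suc n - k)) *\<^sub>R v k)"
  proof -
    have "real (Suc n - k) * c (Suc n - k) = - c (n - k)" if "k \<le> n" for k
      using c_rec[of "n - k"] that by (simp add: Suc_diff_le)
    then show ?thesis by (simp add: sum_negf)
  qed
  finally have "D (frag_coeff \<gamma> \<kappa> n) + c n *\<^sub>R \<kappa> =
      (\<Sum>k\<le>Suc n. (real k * c (Suc n - k)) *\<^sub>R v k + (real (Suc n - k) * c (Suc n - k)) *\<^sub>R v k)"
    unfolding sum.distrib by (simp only: diff_minus_eq_add diff_add_cancel)
  also have "\<dots> = real (Suc n) *\<^sub>R (\<Sum>k\<le>Suc n. c (Suc n - k) *\<^sub>R v k)"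
    unfolding scaleR_sum_right by (intro sum.cong) (auto simp: of_nat_diff algebra_simps)
  finally have "(1 / real (n + 1)) *\<^sub>R (D (frag_coeff \<gamma> \<kappa> n) + c n *\<^sub>R \<kappa>) =
      (\<Sum>k\<le>Suc n. c (Suc n - k) *\<^sub>R v k)" by simp
  then show ?case
    unfolding frag_coeff.simps sdensity_rpow_eq_unit_weight[OF \<gamma> ssupport_frag_coeff[OF \<gamma> \<kappa>]]
    by (simp only: D_def c_def v_def add.commute diff_conv_add_uminus)
qed simp

text \<open>The bounds \<open>1 / j!\<close> and \<open>(1 + \<parallel>\<kappa>\<parallel>)\<^sup>k / k!\<close> of the two factors are the coefficients of \<open>e\<^sup>s\<close> and of
\<open>e\<close> to the power \<open>(1 + \<parallel>\<kappa>\<parallel>) s\<close>, whose product has the coefficients \<open>(2 + \<parallel>\<kappa>\<parallel>)\<^sup>n / n!\<close>.\<close>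

lemma norm_frag_coeff:
  assumes \<gamma>: "0 \<le> \<gamma>" and \<kappa>: "ssupport \<kappa> \<subseteq> {0..1}" "snonneg \<kappa>"
  shows "norm (frag_coeff \<gamma> \<kappa> n) \<le> (2 + norm \<kappa>) ^ n / fact n"
proof -
  have "norm (frag_coeff \<gamma> \<kappa> n) \<le> (\<Sum>k\<le>n. 1 / fact (n - k) * norm (frag_exp_coeff \<gamma> \<kappa> k))"
    unfolding frag_coeff_eq_sum[OF \<gamma> \<kappa>(1)]
    by (rule order_trans[OF norm_sum]) (simp add: power_abs)
  also have "\<dots> \<le> (\<Sum>k\<le>n. 1 / fact (n - k) * ((1 + norm \<kappa>) ^ k / fact k))"
    by (intro sum_mono mult_left_mono norm_frag_exp_coeff \<kappa>) simp
  also have "\<dots> = ((1 + norm \<kappa>) + 1) ^ n / fact n"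
    using exp_series_add_commuting[of "1 + norm \<kappa>" 1 n]
    by (simp add: field_simps)
  finally show ?thesis by (simp add: add.commute add.left_commute)
qed

lemma summable_power_over_fact: "summable (\<lambda>n. x ^ n / fact n)" for x :: real
  using summable_exp[of x] by (simp add: divide_inverse mult.commute)

text \<open>By the Cauchy product, the sum is \<open>e\<^sup>-\<^sup>s\<close> times a series with non-negative terms.\<close>

lemma frag_coeff_series_nonneg:
  assumes \<gamma>: "0 \<le> \<gamma>" and \<kappa>: "ssupport \<kappa> \<subseteq> {0..1}" "snonneg \<kappa>"
    and s: "0 \<le> s" and B: "B \<in> sets borel"
  shows "0 \<le> (\<Sum>n. s ^ n * smeas (frag_coeff \<gamma> \<kappa> n) B)"
proof -
  define w where "w k = s ^ k * smeas (frag_exp_coeff \<gamma> \<kappa> k) B" for k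
  define e where "e j = (- s) ^ j / fact j" for j :: nat
  have w_nonneg: "0 \<le> w k" for k
    using snonneg_frag_exp_coeff[OF \<kappa>(2)] s B by (auto simp: w_def snonneg_def)
  have "norm (w k) \<le> (s * (1 + norm \<kappa>)) ^ k / fact k" for k
  proof -
    have "norm (w k) \<le> s ^ k * ((1 + norm \<kappa>) ^ k / fact k)"
      unfolding w_def norm_mult
      using s order_trans[OF smeas_le_norm norm_frag_exp_coeff[OF \<kappa>(2)]]
      by (intro mult_mono) auto
    then show ?thesis by (simp add: power_mult_distrib)
  qed
  then have w: "summable (\<lambda>k. norm (w k))"
    by (intro summable_comparison_test'[OF summable_power_over_fact[of "s * (1 + norm \<kappa>)"]]) simp
  have e: "summable (\<lambda>k. norm (e k))"
    using summable_power_over_fact[of "\<bar>s\<bar>"] by (simp add: e_def power_abs)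
  have "s ^ n * smeas (frag_coeff \<gamma> \<kappa> n) B = (\<Sum>k\<le>n. w k * e (n - k))" for n
    unfolding frag_coeff_eq_sum[OF \<gamma> \<kappa>(1)] smeas_sum sum_distrib_left
  proof (intro sum.cong refl)
    fix k assume "k \<in> {..n}"
    then have "s ^ n = s ^ k * s ^ (n - k)" by (simp flip: power_add)
    then show "s ^ n * smeas (((- 1) ^ (n - k) / fact (n - k)) *\<^sub>R frag_exp_coeff \<gamma> \<kappa> k) B = w k * e (n - k)"
      by (simp add: w_def e_def power_minus[of s])
  qed
  then have "(\<Sum>n. s ^ n * smeas (frag_coeff \<gamma> \<kappa> n) B) = (\<Sum>k. w k) * (\<Sum>k. e k)"
    using Cauchy_product[OF w e] by simp
  also have "(\<Sum>k. e k) = exp (- s)"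
    by (simp add: e_def exp_def divide_inverse mult.commute)
  also have "0 \<le> (\<Sum>k. w k) * exp (- s)"
    using w_nonneg summable_norm_cancel[OF w] by (simp add: suminf_nonneg)
  finally show ?thesis .
qed

section \<open>Superposition over the initial datum\<close>

text \<open>Both claims rest on the same majorant \<open>q\<^sub>n = (\<alpha> t R (2 + \<parallel>\<kappa>\<parallel>))\<^sup>n / n!\<close>, where \<open>R\<close> bounds \<open>x\<^sup>\<gamma>\<close> on the
support of \<open>\<mu>\<^sub>0\<close>: it dominates the terms of the series in norm, up to the mass of \<open>\<mu>\<^sub>0\<close>, and the
integrands pointwise, which allows summation under the integral sign.\<close>

lemma frag_series_summable_and_nonneg:
  assumes \<gamma>: "0 \<le> \<gamma>" and \<kappa>: "ssupport \<kappa> \<subseteq> {0..1}" "snonneg \<kappa>"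
    and \<mu>\<^sub>0: "snonneg \<mu>\<^sub>0" "ssupport \<mu>\<^sub>0 \<subseteq> {0..L}" and \<alpha>t: "0 \<le> \<alpha> * t"
  shows "summable (frag_term \<alpha> \<gamma> \<kappa> \<mu>\<^sub>0 t)" and "snonneg (\<Sum>n. frag_term \<alpha> \<gamma> \<kappa> \<mu>\<^sub>0 t n)"
proof -
  define R where "R = rpow L \<gamma>"
  define q where "q n = (\<alpha> * t) ^ n * (R ^ n * ((2 + norm \<kappa>) ^ n / fact n))" for n
  let ?a = "frag_coeff \<gamma> \<kappa>" and ?b = "datum_moment \<gamma> \<mu>\<^sub>0"
  have R: "0 \<le> R" by (simp add: R_def)
  have "q = (\<lambda>n. (\<alpha> * t * R * (2 + norm \<kappa>)) ^ n / fact n)"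
    by (simp add: fun_eq_iff q_def power_mult_distrib)
  then have q: "summable q"
    using summable_power_over_fact[of "\<alpha> * t * R * (2 + norm \<kappa>)"] by simp
  have weight_le: "rpow y (real n * \<gamma>) \<le> R ^ n" if "y \<in> {0..L}" for y n
    unfolding rpow_of_nat_mult R_def using that \<gamma> by (intro power_mono rpow_mono) auto
  have weight_int: "sintegrable \<mu>\<^sub>0 (\<lambda>y. rpow y (real n * \<gamma>))" for n
    by (rule sintegrable_bounded_support[OF _ \<mu>\<^sub>0(2), where B = "R ^ n"]) (auto simp: weight_le)
  have b: "snonneg (?b n)" "norm (?b n) \<le> R ^ n * norm \<mu>\<^sub>0" for n
    unfolding datum_moment_def
    using weight_le by (auto intro!: snonneg_sdensity \<mu>\<^sub>0 weight_int norm_sdensity_snonneg[OF _ _ \<mu>\<^sub>0(2)])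
  have "norm (frag_term \<alpha> \<gamma> \<kappa> \<mu>\<^sub>0 t n) \<le> q n * norm \<mu>\<^sub>0" for n
  proof -
    have "norm (mellin_conv (?a n) (?b n)) \<le> ((2 + norm \<kappa>) ^ n / fact n) * (R ^ n * norm \<mu>\<^sub>0)"
      using norm_frag_coeff[OF \<gamma> \<kappa>] b(2)
      by (intro order_trans[OF norm_mellin_conv_le[OF b(1)]] mult_mono) auto
    then have "(\<alpha> * t) ^ n * norm (mellin_conv (?a n) (?b n)) \<le>
        (\<alpha> * t) ^ n * (((2 + norm \<kappa>) ^ n / fact n) * (R ^ n * norm \<mu>\<^sub>0))"
      using \<alpha>t by (intro mult_left_mono) auto
    then show ?thesis using \<alpha>t by (simp add: frag_term_def q_def power_abs mult_ac)
  qed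
  with q show summ: "summable (frag_term \<alpha> \<gamma> \<kappa> \<mu>\<^sub>0 t)"
    by (intro summable_comparison_test'[OF summable_mult2[OF q, of "norm \<mu>\<^sub>0"]]) auto
  show "snonneg (\<Sum>n. frag_term \<alpha> \<gamma> \<kappa> \<mu>\<^sub>0 t n)"
    unfolding snonneg_def
  proof
    fix A :: "real set" assume A [measurable]: "A \<in> sets borel"
    define f where "f n y = (\<alpha> * t) ^ n * (rpow y (real n * \<gamma>) * smeas (?a n) ((\<lambda>x. x * y) -` A))" for n y
    have f_m [measurable]: "f n \<in> borel_measurable borel" for n
      unfolding f_def by measurable
    have f_le: "\<bar>f n y\<bar> \<le> q n" if "y \<in> {0..L}" for n y
    proof -
      have "\<bar>c ^ n * (w * x)\<bar> = c ^ n * (w * \<bar>x\<bar>)" if "0 \<le> c" "0 \<le> w" for c w x :: real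
        using that by (simp add: abs_mult)
      then have "\<bar>f n y\<bar> = (\<alpha> * t) ^ n * (rpow y (real n * \<gamma>) * \<bar>smeas (?a n) ((\<lambda>x. x * y) -` A)\<bar>)"
        unfolding f_def using \<alpha>t rpow_nonneg by blast
      also have "\<dots> \<le> q n"
        unfolding q_def using \<alpha>t R weight_le[OF that]
          order_trans[OF smeas_le_norm norm_frag_coeff[OF \<gamma> \<kappa>]]
        by (intro mult_left_mono mult_mono) auto
      finally show ?thesis .
    qed
    have f_int: "sintegrable \<mu>\<^sub>0 (f n)" for n
      by (rule sintegrable_bounded_support[OF _ \<mu>\<^sub>0(2), where B = "q n"]) (auto intro: f_le)
    have term_integral: "smeas (frag_term \<alpha> \<gamma> \<kappa> \<mu>\<^sub>0 t n) A = (\<integral>y. f n y \<partial>pos_part \<mu>\<^sub>0)" for n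
    proof -
      let ?s = "\<lambda>y. smeas (?a n) ((\<lambda>x. x * y) -` A)"
      have "sintegrable \<mu>\<^sub>0 (\<lambda>y. rpow y (real n * \<gamma>) * ?s y)"
      proof (rule sintegrable_bounded_support[OF _ \<mu>\<^sub>0(2), where B = "R ^ n * norm (?a n)"])
        fix y assume "y \<in> {0..L}"
        then show "\<bar>rpow y (real n * \<gamma>) * ?s y\<bar> \<le> R ^ n * norm (?a n)"
          unfolding abs_mult using R weight_le smeas_le_norm by (intro mult_mono) auto
      qed auto
      then have "smeas (mellin_conv (?a n) (?b n)) A = sintegral \<mu>\<^sub>0 (\<lambda>y. rpow y (real n * \<gamma>) * ?s y)"
        unfolding smeas_mellin_conv_preimage[OF A] datum_moment_def
        by (intro sintegral_sdensity weight_int) auto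
      then show ?thesis
        unfolding sintegral_snonneg[OF \<mu>\<^sub>0(1), symmetric] f_def
        by (simp add: frag_term_def sintegral_cmult)
    qed
    have AE_L: "AE y in pos_part \<mu>\<^sub>0. y \<in> {0..L}"
      by (rule AE_parts_support(1)[OF _ \<mu>\<^sub>0(2)]) simp
    have "(\<integral>y. (\<Sum>n. f n y) \<partial>pos_part \<mu>\<^sub>0) = (\<Sum>n. \<integral>y. f n y \<partial>pos_part \<mu>\<^sub>0)"
    proof (rule integral_suminf)
      show i: "integrable (pos_part \<mu>\<^sub>0) (f n)" for n using f_int by (simp add: sintegrable_def)
      have "summable (\<lambda>n. norm (f n y))" if "y \<in> {0..L}" for y
        using f_le[OF that] by (intro summable_comparison_test'[OF q]) auto
      with AE_L show "AE y in pos_part \<mu>\<^sub>0. summable (\<lambda>n. norm (f n y))"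
        by (auto elim: eventually_mono)
      interpret finite_measure "pos_part \<mu>\<^sub>0" by (rule finite_pos_part)
      have "AE y in pos_part \<mu>\<^sub>0. norm (f n y) \<le> q n" for n
        using AE_L by eventually_elim (simp add: f_le)
      then have "(\<integral>y. norm (f n y) \<partial>pos_part \<mu>\<^sub>0) \<le> (\<integral>y. q n \<partial>pos_part \<mu>\<^sub>0)" for n
        using i by (intro integral_mono_AE) simp_all
      then have "norm (\<integral>y. norm (f n y) \<partial>pos_part \<mu>\<^sub>0) \<le> q n * measure (pos_part \<mu>\<^sub>0) UNIV" for n
        by (simp add: mult.commute)
      then show "summable (\<lambda>n. \<integral>y. norm (f n y) \<partial>pos_part \<mu>\<^sub>0)"
        by (intro summable_comparison_test'[OF summable_mult2[OF q]])
    qed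
    also have "\<dots> = smeas (\<Sum>n. frag_term \<alpha> \<gamma> \<kappa> \<mu>\<^sub>0 t n) A"
      using bounded_linear.suminf[OF bounded_linear_smeas summ, of A] by (simp add: term_integral)
    finally have "smeas (\<Sum>n. frag_term \<alpha> \<gamma> \<kappa> \<mu>\<^sub>0 t n) A = (\<integral>y. (\<Sum>n. f n y) \<partial>pos_part \<mu>\<^sub>0)" ..
    moreover have "0 \<le> (\<Sum>n. f n y)" for y
      unfolding f_def rpow_of_nat_mult mult.assoc[symmetric] power_mult_distrib[symmetric]
      using \<alpha>t by (intro frag_coeff_series_nonneg \<gamma> \<kappa> sets_scaled_preimage A) auto
    ultimately show "0 \<le> smeas (\<Sum>n. frag_term \<alpha> \<gamma> \<kappa> \<mu>\<^sub>0 t n) A" by (simp add: integral_nonneg)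
  qed
qed

theorem theorem3:
  fixes \<alpha> \<gamma> t :: real and \<kappa> \<mu>\<^sub>0 :: smeasure
  assumes "\<alpha> > 0" and "\<gamma> \<ge> 0"
    and "fragmentation_kernel \<kappa>" and "admissible_datum \<mu>\<^sub>0"
    and "t \<ge> 0"
  shows "summable (frag_term \<alpha> \<gamma> \<kappa> \<mu>\<^sub>0 t) \<and> snonneg (frag_solution \<alpha> \<gamma> \<kappa> \<mu>\<^sub>0 t)"
proof -
  have \<kappa>: "ssupport \<kappa> \<subseteq> {0..1}" "snonneg \<kappa>"
    using assms(3) by (auto simp: fragmentation_kernel_def)
  obtain L where \<mu>\<^sub>0: "snonneg \<mu>\<^sub>0" "ssupport \<mu>\<^sub>0 \<subseteq> {0..L}"
    using assms(4) by (auto simp: admissible_datum_def)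
  have \<alpha>t: "0 \<le> \<alpha> * t" using assms by simp
  have "snonneg (sdensity (\<lambda>x. exp (- \<alpha> * rpow x \<gamma> * t)) \<mu>\<^sub>0)"
  proof (rule snonneg_sdensity[OF \<mu>\<^sub>0(1)])
    show "sintegrable \<mu>\<^sub>0 (\<lambda>x. exp (- \<alpha> * rpow x \<gamma> * t))"
      using assms by (intro sintegrable_bounded[where B = 1]) auto
  qed simp
  with frag_series_summable_and_nonneg[OF assms(2) \<kappa> \<mu>\<^sub>0 \<alpha>t] show ?thesis
    by (auto simp: frag_solution_def snonneg_def)
qed

end
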